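(* Let $\mathcal{F}$ be a Furstenberg family such that $\mathrm{span}(\mathcal{E}(S))\subset\mathcal{F}\mathrm{Rec}(S)$ for every continuous linear operator $S$ on a real or complex separable infinite-dimensional F-space. Then for every continuous linear operator $T$ on a real or complex separable infinite-dimensional F-space $X$ which is $\mathcal{F}$-recurrent, there exists an infinite-dimensional $T$-invariant vector subspace $Z\subset X$ with $Z^N\subset\mathcal{F}\mathrm{Rec}(T_{(N)})$ for every $N\in\mathbb{N}$. In particular this applies when $\mathcal{F}$ is any of: the infinite sets $\mathcal{I}$, $\mathcal{AP}$, $\overline{\mathcal{BD}}$, $\overline{\mathcal{D}}$, $\underline{\mathcal{D}}$, $\mathcal{S}$, $\mathcal{IP}^*$, $\Delta^*$; so for an operator that is recurrent (resp. $\mathcal{F}$-recurrent for one of these families) the corresponding set of recurrent vectors contains an infinite-dimensional $T$-invariant subspace.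
   Context: A Furstenberg family is a collection $\mathcal{F}$ of infinite subsets of $\mathbb{N}_0$, closed under supersets, with $A\cap[n,\infty)\in\mathcal{F}$ whenever $A\in\mathcal{F}$, $n\in\mathbb{N}$. $\mathcal{F}\mathrm{Rec}(T)$ is the set of $x$ with $\{n\geq0:T^nx\in U\}\in\mathcal{F}$ for each neighbourhood $U$ of $x$; $T$ is $\mathcal{F}$-recurrent if this set is dense. $\mathcal{E}(T)$: in the complex case, nonzero $x$ with $Tx=\lambda x$, $|\lambda|=1$; in the real case, those $x$ such that $x+iy$ is such an eigenvector of the complexification $\widetilde T(x+iy)=Tx+iTy$ for some $y$. $T_{(N)}=T\oplus\cdots\oplus T$ on $X^N$. Families: $\mathcal{I}$ infinite sets; $\mathcal{AP}$ sets containing arithmetic progressions of every finite length; $\overline{\mathcal{BD}}$, $\overline{\mathcal{D}}$, $\underline{\mathcal{D}}$ sets of positive upper Banach, upper, lower density; $\mathcal{S}$ syndetic sets (bounded gaps); $\mathcal{IP}^*$ sets meeting every IP-set $\{\sum_{k\in F}n_k: F\subset\mathbb{N} \text{ finite nonempty}\}$; $\Delta^*$ sets meeting every $(B-B)\cap\mathbb{N}$ with $B$ infinite. *)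

theory Defs
  imports "HOL-Analysis.Analysis"
begin

record 'v fspace =
  fcarrier :: "'v set"
  vadd :: "'v \<Rightarrow> 'v \<Rightarrow> 'v"
  vzero :: "'v"
  vscale :: "complex \<Rightarrow> 'v \<Rightarrow> 'v"
  scalars :: "complex set"
  vdist :: "'v \<Rightarrow> 'v \<Rightarrow> real"

definition vector_space_on :: "('v, 'z) fspace_scheme \<Rightarrow> bool" where
  "vector_space_on E \<longleftrightarrow>
     (scalars E = (\<real> :: complex set) \<or> scalars E = UNIV) \<and>
     vzero E \<in> fcarrier E \<and>
     (\<forall>x\<in>fcarrier E. \<forall>y\<in>fcarrier E. vadd E x y \<in> fcarrier E) \<and>
     (\<forall>c\<in>scalars E. \<forall>x\<in>fcarrier E. vscale E c x \<in> fcarrier E) \<and>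
     (\<forall>x\<in>fcarrier E. \<forall>y\<in>fcarrier E. \<forall>z\<in>fcarrier E.
        vadd E (vadd E x y) z = vadd E x (vadd E y z)) \<and>
     (\<forall>x\<in>fcarrier E. \<forall>y\<in>fcarrier E. vadd E x y = vadd E y x) \<and>
     (\<forall>x\<in>fcarrier E. vadd E x (vzero E) = x) \<and>
     (\<forall>x\<in>fcarrier E. \<exists>y\<in>fcarrier E. vadd E x y = vzero E) \<and>
     (\<forall>c\<in>scalars E. \<forall>x\<in>fcarrier E. \<forall>y\<in>fcarrier E.
        vscale E c (vadd E x y) = vadd E (vscale E c x) (vscale E c y)) \<and>
     (\<forall>c\<in>scalars E. \<forall>d\<in>scalars E. \<forall>x\<in>fcarrier E.
        vscale E (c + d) x = vadd E (vscale E c x) (vscale E d x)) \<and>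
     (\<forall>c\<in>scalars E. \<forall>d\<in>scalars E. \<forall>x\<in>fcarrier E.
        vscale E (c * d) x = vscale E c (vscale E d x)) \<and>
     (\<forall>x\<in>fcarrier E. vscale E 1 x = x)"

definition ftop :: "('v, 'z) fspace_scheme \<Rightarrow> 'v topology" where
  "ftop E = Metric_space.mtopology (fcarrier E) (vdist E)"

definition F_space :: "('v, 'z) fspace_scheme \<Rightarrow> bool" where
  "F_space E \<longleftrightarrow>
     vector_space_on E \<and>
     Metric_space (fcarrier E) (vdist E) \<and>
     Metric_space.mcomplete (fcarrier E) (vdist E) \<and>
     (\<forall>x\<in>fcarrier E. \<forall>y\<in>fcarrier E. \<forall>z\<in>fcarrier E.
        vdist E (vadd E x z) (vadd E y z) = vdist E x y) \<and>
     continuous_map (prod_topology (ftop E) (ftop E)) (ftop E) (\<lambda>(x, y). vadd E x y) \<and>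
     continuous_map (prod_topology (top_of_set (scalars E)) (ftop E)) (ftop E)
        (\<lambda>(c, x). vscale E c x)"

primrec lincomb :: "('v, 'z) fspace_scheme \<Rightarrow> (complex \<times> 'v) list \<Rightarrow> 'v" where
  "lincomb E [] = vzero E"
| "lincomb E (p # ps) = vadd E (vscale E (fst p) (snd p)) (lincomb E ps)"

definition vspan :: "('v, 'z) fspace_scheme \<Rightarrow> 'v set \<Rightarrow> 'v set" where
  "vspan E S = {lincomb E cs | cs. set cs \<subseteq> scalars E \<times> S}"

definition vsubspace :: "('v, 'z) fspace_scheme \<Rightarrow> 'v set \<Rightarrow> bool" where
  "vsubspace E Z \<longleftrightarrow> Z \<subseteq> fcarrier E \<and> vzero E \<in> Z \<and>
     (\<forall>x\<in>Z. \<forall>y\<in>Z. vadd E x y \<in> Z) \<and> (\<forall>c\<in>scalars E. \<forall>x\<in>Z. vscale E c x \<in> Z)"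

definition infinite_dimensional :: "('v, 'z) fspace_scheme \<Rightarrow> 'v set \<Rightarrow> bool" where
  "infinite_dimensional E Z \<longleftrightarrow> \<not> (\<exists>B. finite B \<and> B \<subseteq> Z \<and> Z \<subseteq> vspan E B)"

definition separable_space :: "('v, 'z) fspace_scheme \<Rightarrow> bool" where
  "separable_space E \<longleftrightarrow>
     (\<exists>D. countable D \<and> D \<subseteq> fcarrier E \<and> ftop E closure_of D = fcarrier E)"

definition sep_inf_F_space :: "('v, 'z) fspace_scheme \<Rightarrow> bool" where
  "sep_inf_F_space E \<longleftrightarrow> F_space E \<and> separable_space E \<and>
     infinite_dimensional E (fcarrier E)"

definition cont_lin_op :: "('v, 'z) fspace_scheme \<Rightarrow> ('v \<Rightarrow> 'v) \<Rightarrow> bool" where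
  "cont_lin_op E T \<longleftrightarrow>
     (\<forall>x\<in>fcarrier E. T x \<in> fcarrier E) \<and>
     (\<forall>x\<in>fcarrier E. \<forall>y\<in>fcarrier E. T (vadd E x y) = vadd E (T x) (T y)) \<and>
     (\<forall>c\<in>scalars E. \<forall>x\<in>fcarrier E. T (vscale E c x) = vscale E c (T x)) \<and>
     continuous_map (ftop E) (ftop E) T"

text \<open>Complex scalar multiplication on the complexification X \<times> X of a real space:
  (a + ib)(x + iy) = (ax - by) + i(bx + ay).\<close>
definition cx_scale :: "('v, 'z) fspace_scheme \<Rightarrow> complex \<Rightarrow> 'v \<times> 'v \<Rightarrow> 'v \<times> 'v" where
  "cx_scale E l p =
     (vadd E (vscale E (of_real (Re l)) (fst p)) (vscale E (of_real (- Im l)) (snd p)),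
      vadd E (vscale E (of_real (Im l)) (fst p)) (vscale E (of_real (Re l)) (snd p)))"

definition cx_op :: "('v \<Rightarrow> 'v) \<Rightarrow> 'v \<times> 'v \<Rightarrow> 'v \<times> 'v" where
  "cx_op T p = (T (fst p), T (snd p))"

definition unimod_eigenvectors :: "('v, 'z) fspace_scheme \<Rightarrow> ('v \<Rightarrow> 'v) \<Rightarrow> 'v set" where
  "unimod_eigenvectors E T =
     (if scalars E = UNIV then
        {x \<in> fcarrier E. x \<noteq> vzero E \<and> (\<exists>l. cmod l = 1 \<and> T x = vscale E l x)}
      else
        {x \<in> fcarrier E. \<exists>y\<in>fcarrier E. (x, y) \<noteq> (vzero E, vzero E) \<and>
           (\<exists>l. cmod l = 1 \<and> cx_op T (x, y) = cx_scale E l (x, y))})"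

definition furstenberg_family :: "nat set set \<Rightarrow> bool" where
  "furstenberg_family F \<longleftrightarrow>
     (\<forall>A\<in>F. infinite A) \<and>
     (\<forall>A\<in>F. \<forall>B. A \<subseteq> B \<longrightarrow> B \<in> F) \<and>
     (\<forall>A\<in>F. \<forall>n. A \<inter> {n..} \<in> F)"

definition frec :: "nat set set \<Rightarrow> 'b topology \<Rightarrow> ('b \<Rightarrow> 'b) \<Rightarrow> 'b set" where
  "frec F X T = {x \<in> topspace X. \<forall>U. openin X U \<and> x \<in> U \<longrightarrow> {n. (T ^^ n) x \<in> U} \<in> F}"

definition F_recurrent :: "nat set set \<Rightarrow> 'b topology \<Rightarrow> ('b \<Rightarrow> 'b) \<Rightarrow> bool" where
  "F_recurrent F X T \<longleftrightarrow> X closure_of (frec F X T) = topspace X"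

definition pow_top :: "('v, 'z) fspace_scheme \<Rightarrow> nat \<Rightarrow> (nat \<Rightarrow> 'v) topology" where
  "pow_top E N = product_topology (\<lambda>_. ftop E) {..<N}"

definition diag_op :: "('v \<Rightarrow> 'v) \<Rightarrow> nat \<Rightarrow> (nat \<Rightarrow> 'v) \<Rightarrow> (nat \<Rightarrow> 'v)" where
  "diag_op T N x = restrict (\<lambda>i. T (x i)) {..<N}"

text \<open>Hypothesis of the theorem. Quantification over all separable F-spaces is
  realised over carriers in the type nat \<Rightarrow> real, which has the cardinality of the
  continuum; every separable metric space embeds in it, and the property is invariant
  under isomorphism.\<close>
definition eigen_hyp :: "nat set set \<Rightarrow> bool" where
  "eigen_hyp F \<longleftrightarrow>
     (\<forall>(E :: (nat \<Rightarrow> real) fspace) S. sep_inf_F_space E \<and> cont_lin_op E S \<longrightarrow>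
        vspan E (unimod_eigenvectors E S) \<subseteq> frec F (ftop E) S)"

definition has_rec_subspace :: "nat set set \<Rightarrow> ('v, 'z) fspace_scheme \<Rightarrow> ('v \<Rightarrow> 'v) \<Rightarrow> bool" where
  "has_rec_subspace F E T \<longleftrightarrow>
     (\<exists>Z. vsubspace E Z \<and> infinite_dimensional E Z \<and> T ` Z \<subseteq> Z \<and>
        (\<forall>N\<ge>1. PiE {..<N} (\<lambda>_. Z) \<subseteq> frec F (pow_top E N) (diag_op T N)))"

definition fam_I :: "nat set set" where
  "fam_I = {A. infinite A}"

definition fam_AP :: "nat set set" where
  "fam_AP = {A. \<forall>k. \<exists>a d. d > 0 \<and> (\<forall>j<k. a + j * d \<in> A)}"

definition upper_Banach_density :: "nat set \<Rightarrow> ereal" where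
  "upper_Banach_density A =
     limsup (\<lambda>N. SUP m. ereal (real (card (A \<inter> {m..<m + N})) / real N))"

definition upper_density :: "nat set \<Rightarrow> ereal" where
  "upper_density A = limsup (\<lambda>N. ereal (real (card (A \<inter> {..<N})) / real N))"

definition lower_density :: "nat set \<Rightarrow> ereal" where
  "lower_density A = liminf (\<lambda>N. ereal (real (card (A \<inter> {..<N})) / real N))"

definition fam_BD :: "nat set set" where
  "fam_BD = {A. upper_Banach_density A > 0}"

definition fam_uD :: "nat set set" where
  "fam_uD = {A. upper_density A > 0}"

definition fam_lD :: "nat set set" where
  "fam_lD = {A. lower_density A > 0}"

definition fam_S :: "nat set set" where
  "fam_S = {A. A \<noteq> {} \<and> (\<exists>m. \<forall>n. \<exists>k\<in>A. n \<le> k \<and> k < n + m)}"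

definition IP_set :: "(nat \<Rightarrow> nat) \<Rightarrow> nat set" where
  "IP_set n = {\<Sum>k\<in>G. n k | G. finite G \<and> G \<noteq> {}}"

definition fam_IPstar :: "nat set set" where
  "fam_IPstar = {A. \<forall>n. (\<forall>k. n k \<ge> 1) \<longrightarrow> A \<inter> IP_set n \<noteq> {}}"

definition fam_Deltastar :: "nat set set" where
  "fam_Deltastar = {A. \<forall>B. infinite B \<longrightarrow> A \<inter> {b - a | a b. a \<in> B \<and> b \<in> B \<and> a < b} \<noteq> {}}"

end

(*
  Let G be the set of x annihilated by a product of distinct factors T - l with |l| = 1 (computed in
  the complexification when X is real). Such an x is a sum of unimodular eigenvectors, so its return
  times contain sets {n. |l^n - 1| < e for all l in L} with L finite; these are in F, hence the powers
  of G consist of F-recurrent vectors.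

  If x is F-recurrent, then the powers of {p(T) x} consist of F-recurrent vectors as well. If
  {p(T) x} is finite-dimensional, some p(T) x = 0 with p nonzero of minimal degree, and the recurrence
  of the vectors q(T) x forces the roots of p to be unimodular and simple, so that x lies in G.

  So if neither G nor any {p(T) x} with x F-recurrent were infinite-dimensional, G would be dense and
  annihilated by a single product of factors T - l; by continuity this product annihilates X, so X = G
  would be finite-dimensional.

  The hypothesis on eigenvectors enters only through the sets of return times above: it is applied to
  a single operator, a rotation of coordinate planes in the space of all real sequences.
*)
theory Submission
  imports Defs "HOL-Computational_Algebra.Fundamental_Theorem_Algebra"
begin

section \<open>Polynomials in an operator\<close>

text \<open>Only convergence of sequences is axiomatised, so that the complexification of a real F-space
  needs no metric.\<close>
locale conv_op =
  fixes C :: "'y set" and add :: "'y \<Rightarrow> 'y \<Rightarrow> 'y" and zero :: 'y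
    and sc :: "complex \<Rightarrow> 'y \<Rightarrow> 'y" and S :: "'y \<Rightarrow> 'y"
    and conv :: "(nat \<Rightarrow> 'y) \<Rightarrow> 'y \<Rightarrow> bool"
  assumes zero_in [simp]: "zero \<in> C"
    and add_in [simp]: "x \<in> C \<Longrightarrow> y \<in> C \<Longrightarrow> add x y \<in> C"
    and sc_in [simp]: "x \<in> C \<Longrightarrow> sc c x \<in> C"
    and S_in [simp]: "x \<in> C \<Longrightarrow> S x \<in> C"
    and add_assoc: "x \<in> C \<Longrightarrow> y \<in> C \<Longrightarrow> z \<in> C \<Longrightarrow> add (add x y) z = add x (add y z)"
    and add_comm: "x \<in> C \<Longrightarrow> y \<in> C \<Longrightarrow> add x y = add y x"
    and add_zero [simp]: "x \<in> C \<Longrightarrow> add x zero = x"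
    and sc_add: "x \<in> C \<Longrightarrow> y \<in> C \<Longrightarrow> sc c (add x y) = add (sc c x) (sc c y)"
    and add_sc: "x \<in> C \<Longrightarrow> sc (c + d) x = add (sc c x) (sc d x)"
    and sc_sc: "x \<in> C \<Longrightarrow> sc c (sc d x) = sc (c * d) x"
    and sc_one [simp]: "x \<in> C \<Longrightarrow> sc 1 x = x"
    and sc_0 [simp]: "x \<in> C \<Longrightarrow> sc 0 x = zero"
    and S_add: "x \<in> C \<Longrightarrow> y \<in> C \<Longrightarrow> S (add x y) = add (S x) (S y)"
    and S_sc: "x \<in> C \<Longrightarrow> S (sc c x) = sc c (S x)"
    and conv_const: "x \<in> C \<Longrightarrow> conv (\<lambda>_. x) x"
    and conv_add: "conv u x \<Longrightarrow> conv v y \<Longrightarrow> conv (\<lambda>n. add (u n) (v n)) (add x y)"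
    and conv_sc: "a \<longlonglongrightarrow> c \<Longrightarrow> conv u x \<Longrightarrow> conv (\<lambda>n. sc (a n) (u n)) (sc c x)"
    and conv_S: "conv u x \<Longrightarrow> conv (\<lambda>n. S (u n)) (S x)"
    and conv_unique: "conv u x \<Longrightarrow> conv u y \<Longrightarrow> x = y"
    and conv_in: "conv u x \<Longrightarrow> u n \<in> C" "conv u x \<Longrightarrow> x \<in> C"
begin

lemma zero_add [simp]: "x \<in> C \<Longrightarrow> add zero x = x"
  using add_comm add_zero zero_in by metis

lemma sc_zero [simp]: "sc c zero = zero"
  using sc_sc[OF zero_in, of c 0] by simp

lemma S_zero [simp]: "S zero = zero"
  using S_sc[OF zero_in, of 0] by simp

lemma add_left_comm:
  "x \<in> C \<Longrightarrow> y \<in> C \<Longrightarrow> z \<in> C \<Longrightarrow> add x (add y z) = add y (add x z)"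
  by (metis add_assoc add_comm)

lemma add_uminus: "x \<in> C \<Longrightarrow> add x (sc (-1) x) = zero"
  using add_sc[of x 1 "-1"] by simp

lemma add_add_uminus: "x \<in> C \<Longrightarrow> y \<in> C \<Longrightarrow> add (add x (sc (-1) y)) y = x"
  by (simp add: add_assoc add_comm[of "sc (-1) y" y] add_uminus)

text \<open>Horner's scheme for p(S) x with the vector carried along, so that no algebra of
  operators is needed.\<close>

definition act :: "complex poly \<Rightarrow> 'y \<Rightarrow> 'y" where
  "act p x = fold_coeffs (\<lambda>a v. add (sc a x) (S v)) p zero"

lemma act_0 [simp]: "act 0 x = zero"
  by (simp add: act_def)

lemma act_pCons: "x \<in> C \<Longrightarrow> act (pCons a p) x = add (sc a x) (S (act p x))"
  \<comment> \<open>\<open>fold_coeffs\<close> skips its step when \<open>a\<close> and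
    \<open>p\<close> both vanish; the right-hand side is \<open>zero\<close> there as well.\<close>
  by (cases "p = 0 \<and> a = 0") (auto simp: act_def)

lemma act_in [simp]: "x \<in> C \<Longrightarrow> act p x \<in> C"
  by (induction p) (auto simp: act_pCons)

lemma act_1 [simp]: "x \<in> C \<Longrightarrow> act 1 x = x"
  by (simp add: act_pCons one_pCons)

lemma act_add: "x \<in> C \<Longrightarrow> act (p + q) x = add (act p x) (act q x)"
proof (induction p q rule: poly_induct2)
  case (pCons a p b q)
  then show ?case
    by (simp add: act_pCons add_sc S_add add_assoc add_left_comm)
qed simp

lemma act_smult: "x \<in> C \<Longrightarrow> act (smult c p) x = sc c (act p x)"
  by (induction p) (simp_all add: act_pCons sc_add sc_sc S_sc)

lemma act_mult: "x \<in> C \<Longrightarrow> act (p * q) x = act p (act q x)"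
  by (induction p) (simp_all add: act_pCons act_add act_smult)

lemma act_commute: "x \<in> C \<Longrightarrow> act p (act q x) = act q (act p x)"
  by (metis act_mult mult.commute)

lemma act_of_add: "x \<in> C \<Longrightarrow> y \<in> C \<Longrightarrow> act p (add x y) = add (act p x) (act p y)"
  by (induction p) (simp_all add: act_pCons sc_add S_add add_assoc add_left_comm)

lemma act_of_sc: "x \<in> C \<Longrightarrow> act p (sc c x) = sc c (act p x)"
  by (induction p) (simp_all add: act_pCons sc_add S_sc sc_sc mult.commute)

lemma act_X: "x \<in> C \<Longrightarrow> act [:0, 1:] x = S x"
  by (simp add: act_pCons)

lemma act_of_S: "x \<in> C \<Longrightarrow> act p (S x) = S (act p x)"
  by (metis act_X act_commute act_in)

lemma act_linear_factor: "x \<in> C \<Longrightarrow> act [:- l, 1:] x = add (S x) (sc (- l) x)"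
  by (simp add: act_pCons add_comm)

lemma act_zero [simp]: "act p zero = zero"
  by (induction p) (simp_all add: act_pCons)

lemma eigen_iff: "x \<in> C \<Longrightarrow> act [:- l, 1:] x = zero \<longleftrightarrow> S x = sc l x"
proof
  assume x: "x \<in> C" and "act [:- l, 1:] x = zero"
  moreover have "add (add (S x) (sc (-1) (sc l x))) (sc l x) = S x"
    using x by (intro add_add_uminus) auto
  ultimately show "S x = sc l x"
    by (simp add: act_linear_factor sc_sc)
next
  assume x: "x \<in> C" and "S x = sc l x"
  then show "act [:- l, 1:] x = zero"
    by (simp add: act_linear_factor add_sc[symmetric])
qed

lemma funpow_in [simp]: "x \<in> C \<Longrightarrow> (S ^^ n) x \<in> C"
  by (induction n) auto

lemma act_funpow: "x \<in> C \<Longrightarrow> act p ((S ^^ n) x) = (S ^^ n) (act p x)"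
  by (induction n) (simp_all add: act_of_S)

lemma act_monom: "x \<in> C \<Longrightarrow> act (monom 1 n) x = (S ^^ n) x"
  by (induction n) (simp_all add: monom_Suc act_pCons)

lemma conv_act: "conv u x \<Longrightarrow> conv (\<lambda>n. act p (u n)) (act p x)"
proof (induction p)
  case (pCons a p)
  have "conv (\<lambda>n. add (sc a (u n)) (S (act p (u n)))) (add (sc a x) (S (act p x)))"
    by (intro conv_add conv_sc conv_S pCons tendsto_const)
  then show ?case
    using conv_in[OF pCons.prems] by (simp add: act_pCons)
qed (simp add: conv_const)

lemma act_eigen: "x \<in> C \<Longrightarrow> S x = sc l x \<Longrightarrow> act p x = sc (poly p l) x"
  by (induction p) (simp_all add: act_pCons S_sc sc_sc add_sc mult.commute)

lemma funpow_eigen: "x \<in> C \<Longrightarrow> S x = sc l x \<Longrightarrow> (S ^^ n) x = sc (l ^ n) x"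
  by (induction n) (simp_all add: S_sc sc_sc mult.commute)

text \<open>p(S) is continuous and commutes with the powers of S, so p(S) x returns along the very
  times at which x does.\<close>

lemma recurrent_act:
  "conv (\<lambda>k. (S ^^ n k) x) x \<Longrightarrow> conv (\<lambda>k. (S ^^ n k) (act p x)) (act p x)"
  using conv_act[of "\<lambda>k. (S ^^ n k) x" x p] conv_in(2) by (simp add: act_funpow)

section \<open>Recurrence and the spectral structure of annihilated vectors\<close>

text \<open>If |l| < 1, the orbit tends to zero. If |l| > 1, multiplying the returning sequence by
  l^(-n) turns it into the constant x and forces its limit to be zero. Uniqueness of limits excludes
  both.\<close>

lemma recurrent_eigenvalue_unimodular:
  assumes x: "x \<in> C" and eig: "S x = sc l x" and nz: "x \<noteq> zero"
    and rec: "conv (\<lambda>k. (S ^^ n k) x) x" and n: "filterlim n at_top sequentially"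
  shows "cmod l = 1"
proof (rule ccontr)
  assume "cmod l \<noteq> 1"
  \<comment> \<open>The value l = 0 falls under the first case, so l can be inverted in the
    second.\<close>
  then consider "cmod l < 1" | "cmod (inverse l) < 1" "l \<noteq> 0"
    using inverse_less_1_iff[of "cmod l"] by (fastforce simp: norm_inverse)
  then have "conv (\<lambda>_::nat. x) zero \<or> conv (\<lambda>k. (S ^^ n k) x) zero"
  proof cases
    case 1
    have "(\<lambda>k. l ^ n k) \<longlonglongrightarrow> 0"
      using filterlim_compose[OF LIMSEQ_power_zero[OF 1] n] .
    from conv_sc[OF this conv_const[OF x]] show ?thesis
      using x by (simp add: funpow_eigen[OF x eig])
  next
    case 2
    have "(\<lambda>k. inverse l ^ n k) \<longlonglongrightarrow> 0"
      using filterlim_compose[OF LIMSEQ_power_zero[OF 2(1)] n] .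
    from conv_sc[OF this rec] show ?thesis
      using x 2(2) by (simp add: funpow_eigen[OF x eig] sc_sc flip: power_mult_distrib)
  qed
  then show False
    using conv_unique[OF rec] conv_unique[OF conv_const[OF x]] nz by blast
qed

text \<open>On a Jordan block S^n x grows like n times w. Dividing by n l^(n-1) along the return
  times, recurrence gives the limit zero and the explicit formula gives the limit w.\<close>

lemma recurrent_no_Jordan_block:
  assumes x: "x \<in> C" and w: "w \<in> C" and Sx: "S x = add (sc l x) w" and Sw: "S w = sc l w"
    and l: "cmod l = 1"
    and rec: "conv (\<lambda>k. (S ^^ n k) x) x" and n: "filterlim n at_top sequentially"
  shows "w = zero"
proof -
  have l0: "l \<noteq> 0" using l by auto
  \<comment> \<open>The usual coefficient n l^(n-1) is written as n l^n / l, which avoids a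
    truncated exponent at n = 0.\<close>
  have pow: "(S ^^ m) x = add (sc (l ^ m) x) (sc (of_nat m * l ^ m / l) w)" for m
  proof (induction m)
    case (Suc m)
    have "(S ^^ Suc m) x = add (sc (l ^ m) (add (sc l x) w)) (sc (of_nat m * l ^ m) w)"
      using x w l0 by (simp add: Suc S_add S_sc Sx Sw sc_sc)
    also have "\<dots> = add (sc (l ^ Suc m) x) (sc (l ^ m + of_nat m * l ^ m) w)"
      using x w by (simp add: sc_add sc_sc add_assoc add_sc mult.commute)
    also have "l ^ m + of_nat m * l ^ m = of_nat (Suc m) * l ^ Suc m / l"
      using l0 by (simp add: field_simps)
    finally show ?case .
  qed (use x w in simp)
  define a where "a k = inverse (of_nat (n k) :: complex)" for k
  have "(\<lambda>k. inverse (of_nat (n k)) :: real) \<longlonglongrightarrow> 0"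
    using filterlim_compose[OF lim_inverse_n n] by simp
  then have a: "a \<longlonglongrightarrow> 0"
    by (intro tendsto_norm_zero_cancel[of a]) (simp add: a_def norm_inverse)
  \<comment> \<open>The factor is the inverse of the coefficient of w in \<open>pow\<close>, taken
    at the time \<open>n k\<close>.\<close>
  have "(\<lambda>k. a k * (l * inverse l ^ n k)) \<longlonglongrightarrow> 0"
    by (intro tendsto_norm_zero_cancel[of "\<lambda>k. a k * (l * inverse l ^ n k)"])
      (use tendsto_norm_zero[OF a] l in \<open>simp add: norm_mult norm_power norm_inverse\<close>)
  from conv_sc[OF this rec] 
  have 1: "conv (\<lambda>k. sc (a k * (l * inverse l ^ n k)) ((S ^^ n k) x)) zero"
    using x by simp
  \<comment> \<open>Equality with 1 holds only once \<open>n k\<close> is positive, because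
    \<open>inverse 0\<close> is 0.\<close>
  have "(\<lambda>k. a k * of_nat (n k)) \<longlonglongrightarrow> 1"
  proof (rule tendsto_eventually)
    have "eventually (\<lambda>k. n k > 0) sequentially"
      using n by (rule eventually_compose_filterlim[OF eventually_gt_at_top])
    then show "eventually (\<lambda>k. a k * of_nat (n k) = 1) sequentially"
      by eventually_elim (simp add: a_def)
  qed
  moreover have "(\<lambda>k. a k * l) \<longlonglongrightarrow> 0 * l"
    by (intro tendsto_intros a)
  ultimately have 2: "conv (\<lambda>k. add (sc (a k * l) x) (sc (a k * of_nat (n k)) w)) (add zero w)"
    using conv_add[OF conv_sc[OF _ conv_const[OF x]] conv_sc[OF _ conv_const[OF w]],
        of "\<lambda>k. a k * l" 0 "\<lambda>k. a k * of_nat (n k)" 1] x w by simp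
  have "sc (a k * (l * inverse l ^ n k)) ((S ^^ n k) x) =
      add (sc (a k * l) x) (sc (a k * of_nat (n k)) w)" for k
    using x w l0 by (simp add: pow sc_add sc_sc field_simps)
  with 1 2 conv_unique show ?thesis
    using w by simp
qed

text \<open>Indexing by a set makes every root simple; annihilation by such a product amounts to
  diagonalisability.\<close>

definition lin_factors :: "complex set \<Rightarrow> complex poly" where
  "lin_factors L = (\<Prod>l\<in>L. [:- l, 1:])"

text \<open>Among the nonzero annihilators of x take m of least degree. Its proper divisors do not
  kill x, so its roots produce nonzero vectors q(S) x to which the two preceding lemmas
  apply.\<close>

lemma recurrent_annihilated:
  assumes x: "x \<in> C" and p: "p \<noteq> 0" "act p x = zero"
    and rec: "conv (\<lambda>k. (S ^^ n k) x) x" and n: "filterlim n at_top sequentially"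
  obtains L where "finite L" "L \<subseteq> sphere 0 1" "act (lin_factors L) x = zero"
proof -
  obtain m where m: "m \<noteq> 0" "act m x = zero"
    and min: "\<And>q. q \<noteq> 0 \<Longrightarrow> act q x = zero \<Longrightarrow> degree m \<le> degree q"
    using p exists_least_iff[of "\<lambda>d. \<exists>q. q \<noteq> 0 \<and> act q x = zero \<and> degree q = d"]
    by (metis not_le)
  \<comment> \<open>With m = (X - l) q, minimality makes q(S) x a nonzero eigenvector for l, and it
    is recurrent.\<close>
  have unimod: "cmod l = 1" if "poly m l = 0" for l
  proof -
    from that have "[:- l, 1:] dvd m" by (simp only: poly_eq_0_iff_dvd)
    then obtain q where q: "m = [:- l, 1:] * q" by (rule dvdE)
    with m have q0: "q \<noteq> 0" by auto
    then have "degree q < degree m"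
      unfolding q by (simp add: degree_mult_eq del: mult_pCons_left)
    then have "act q x \<noteq> zero"
      using min[OF q0] by auto
    moreover have "S (act q x) = sc l (act q x)"
      using m(2) x by (simp add: q act_mult eigen_iff del: mult_pCons_left)
    ultimately show ?thesis
      using recurrent_eigenvalue_unimodular[OF _ _ _ recurrent_act[OF rec] n] x by auto
  qed
  have "rsquarefree m"
    unfolding rsquarefree_def
  proof (intro conjI allI m(1))
    fix l show "order l m = 0 \<or> order l m = 1"
    proof (rule ccontr)
      \<comment> \<open>With m = (X - l)^2 q, the vectors y = q(S) x and w = (S - l) y would form a
        Jordan block with w nonzero.\<close>
      assume "\<not> ?thesis"
      then have "2 \<le> order l m" by linarith
      then have "[:- l, 1:] ^ 2 dvd m"
        using power_le_dvd[OF order_1] by blast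
      then obtain q where q: "m = [:- l, 1:] ^ 2 * q" by auto
      with m have q0: "q \<noteq> 0" by auto
      define y where "y = act q x"
      define w where "w = act [:- l, 1:] y"
      have y: "y \<in> C" and w: "w \<in> C" using x by (auto simp: y_def w_def)
      have "degree ([:- l, 1:] * q) < degree m"
        unfolding q using q0 by (simp add: degree_mult_eq degree_power_eq del: mult_pCons_left)
      then have "w \<noteq> zero"
        using min[of "[:- l, 1:] * q"] q0 x
        by (auto simp: w_def y_def act_mult simp del: mult_pCons_left)
      moreover have "m = [:- l, 1:] * ([:- l, 1:] * q)"
        by (simp only: q power2_eq_square mult.assoc)
      then have "act [:- l, 1:] w = zero"
        using m(2) x by (simp add: w_def y_def act_mult del: mult_pCons_left)
      then have "S w = sc l w"
        using w by (simp add: eigen_iff)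
      moreover have "S y = add (sc l y) w"
        using y add_add_uminus[of "S y" "sc l y"]
        by (simp add: w_def act_linear_factor sc_sc add_comm)
      moreover have "cmod l = 1"
        by (rule unimod) (simp add: q)
      ultimately show False
        using recurrent_no_Jordan_block[OF y w _ _ _ _ n] recurrent_act[OF rec, of q] y_def by metis
    qed
  qed
  \<comment> \<open>The fundamental theorem of algebra splits the squarefree m into distinct linear
    factors.\<close>
  then have "m = smult (lead_coeff m) (lin_factors {z. poly m z = 0})"
    unfolding lin_factors_def by (simp add: complex_poly_decompose_rsquarefree)
  then have "act (smult (lead_coeff m) (lin_factors {z. poly m z = 0})) x = zero"
    using m by simp
  then have "sc (lead_coeff m) (act (lin_factors {z. poly m z = 0}) x) = zero"
    using x by (simp add: act_smult)
  then have "sc (inverse (lead_coeff m)) (sc (lead_coeff m) (act (lin_factors {z. poly m z = 0}) x)) = zero"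
    by simp
  then have "act (lin_factors {z. poly m z = 0}) x = zero"
    using x m by (simp add: sc_sc)
  moreover have "finite {z. poly m z = 0}"
    using m poly_roots_finite by blast
  moreover have "{z. poly m z = 0} \<subseteq> sphere 0 1"
    using unimod by auto
  ultimately show ?thesis
    using that by blast
qed

text \<open>Serves to give finitely many vectors a common annihilator by uniting their root
  sets.\<close>

lemma lin_factors_mono:
  assumes "L \<subseteq> M" "finite M" "x \<in> C" "act (lin_factors L) x = zero"
  shows "act (lin_factors M) x = zero"
proof -
  have "lin_factors M = lin_factors (M - L) * lin_factors L"
    unfolding lin_factors_def using assms by (metis prod.subset_diff)
  then show ?thesis using assms by (simp add: act_mult)
qed

text \<open>Partial fractions, one root at a time: x splits as y + c w, where S w = m w and y is
  killed by the factors for L. Each summand returns along the given times.\<close>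

lemma conv_funpow_annihilated:
  assumes "finite L" "x \<in> C" "act (lin_factors L) x = zero"
    and "\<And>l. l \<in> L \<Longrightarrow> (\<lambda>k. l ^ n k) \<longlonglongrightarrow> 1"
  shows "conv (\<lambda>k. (S ^^ n k) x) x"
  using assms
proof (induction L arbitrary: x rule: finite_induct)
  case empty
  then show ?case using act_1[of x] funpow_eigen[of zero 1]
    by (simp add: lin_factors_def conv_const)
next
  case (insert m L)
  define w where "w = act (lin_factors L) x"
  \<comment> \<open>Scaled so that the factors for L send c w to w, the image of x, and hence kill x
    - c w.\<close>
  define c where "c = inverse (poly (lin_factors L) m)"
  have [simp]: "w \<in> C" using insert by (simp add: w_def)
  have "act [:- m, 1:] w = zero"
    using insert by (simp add: w_def lin_factors_def act_mult flip: act_mult del: mult_pCons_left)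
  then have w: "S w = sc m w" by (simp add: eigen_iff)
  have "poly (lin_factors L) m \<noteq> 0"
    using insert by (auto simp: lin_factors_def poly_prod)
  then have c: "c * poly (lin_factors L) m = 1" by (simp add: c_def)
  define y where "y = add x (sc (- c) w)"
  have [simp]: "y \<in> C" using insert by (simp add: y_def)
  have "act (lin_factors L) y = add w (sc (- 1) w)"
    using insert c by (simp add: y_def act_of_add act_of_sc act_eigen[OF _ w] sc_sc w_def[symmetric])
  then have "conv (\<lambda>k. (S ^^ n k) y) y"
    using insert by (simp add: add_uminus)
  moreover have "conv (\<lambda>k. sc (m ^ n k) (sc c w)) (sc 1 (sc c w))"
    using insert by (intro conv_sc conv_const) auto
  ultimately have "conv (\<lambda>k. add ((S ^^ n k) y) (sc (m ^ n k) (sc c w))) (add y (sc c w))"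
    using conv_add by fastforce
  moreover have x: "x = add y (sc c w)"
    using insert add_add_uminus[of x "sc c w"] by (simp add: y_def sc_sc)
  moreover have "(S ^^ i) x = add ((S ^^ i) y) (sc (m ^ i) (sc c w))" for i
    unfolding x by (induction i) (simp_all add: S_add S_sc w sc_sc mult_ac)
  ultimately show ?case by simp
qed

end

section \<open>Families containing the return times of rotations\<close>

text \<open>The common interface for both halves of the theorem. The sets in the last clause are the
  simultaneous return times to 1 of finitely many rotations of the circle.\<close>

definition rotation_family :: "nat set set \<Rightarrow> bool" where
  "rotation_family F \<longleftrightarrow>
     (\<forall>A\<in>F. infinite A) \<and> (\<forall>A\<in>F. \<forall>B. A \<subseteq> B \<longrightarrow> B \<in> F) \<and>
     (\<forall>L e. finite L \<and> L \<subseteq> sphere 0 1 \<and> e > 0 \<longrightarrow> {n. \<forall>l\<in>L. cmod (l ^ n - 1) < e} \<in> F)"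

text \<open>Pigeonhole preparation: f n records, for each l in L, the cell of a square grid
  containing l^n. Equal records make l^m and l^n close, and dividing by the unimodular l^m leaves a
  return to 1.\<close>

lemma rotation_discretisation:
  assumes L: "finite L" "L \<subseteq> sphere 0 1" and e: "e > 0"
  obtains f :: "nat \<Rightarrow> complex \<Rightarrow> int \<times> int" where "finite (range f)"
    "\<And>m n l. m \<le> n \<Longrightarrow> f m = f n \<Longrightarrow> l \<in> L \<Longrightarrow> cmod (l ^ (n - m) - 1) < e"
proof
  \<comment> \<open>The cells have side e / 2: the modulus is at most the sum of the two coordinate
    differences.\<close>
  define K where "K = 2 / e"
  have K: "K > 0" using e by (simp add: K_def)
  define g where "g z = (\<lfloor>Re z * K\<rfloor>, \<lfloor>Im z * K\<rfloor>)" for z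
  \<comment> \<open>Restricting to L places all records in one finite \<open>PiE\<close>.\<close>
  define f where "f n = restrict (\<lambda>l. g (l ^ n)) L" for n :: nat
  have fl: "\<lfloor>t * K\<rfloor> \<in> {\<lfloor>- K\<rfloor>..\<lfloor>K\<rfloor>}" if "\<bar>t\<bar> \<le> 1" for t
    using that K mult_right_mono[of t 1 K] mult_right_mono[of "-1" t K]
    by (auto intro!: floor_mono)
  have "f n \<in> PiE L (\<lambda>_. {\<lfloor>- K\<rfloor>..\<lfloor>K\<rfloor>} \<times> {\<lfloor>- K\<rfloor>..\<lfloor>K\<rfloor>})" for n
  proof -
    have "cmod (l ^ n) = 1" if "l \<in> L" for l using L that by (auto simp: norm_power)
    then have "\<bar>Re (l ^ n)\<bar> \<le> 1" "\<bar>Im (l ^ n)\<bar> \<le> 1" if "l \<in> L" for l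
      using that abs_Re_le_cmod abs_Im_le_cmod by metis+
    then show ?thesis unfolding f_def g_def by (intro restrict_PiE_iff[THEN iffD2] ballI SigmaI fl)
  qed
  then have "range f \<subseteq> PiE L (\<lambda>_. {\<lfloor>- K\<rfloor>..\<lfloor>K\<rfloor>} \<times> {\<lfloor>- K\<rfloor>..\<lfloor>K\<rfloor>})"
    by blast
  then show "finite (range f)"
    by (rule finite_subset) (intro finite_PiE L finite_cartesian_product finite_atLeastAtMost_int)
  fix m n l assume mn: "m \<le> n" "f m = f n" and l: "l \<in> L"
  then have "g (l ^ m) = g (l ^ n)" unfolding f_def by (metis restrict_apply')
  then have "\<bar>Re (l ^ n - l ^ m) * K\<bar> < 1" "\<bar>Im (l ^ n - l ^ m) * K\<bar> < 1"
    unfolding g_def by (simp_all add: left_diff_distrib) linarith+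
  moreover have "\<bar>t * K\<bar> < 1 \<longleftrightarrow> \<bar>t\<bar> < e / 2" for t
    using e unfolding abs_mult K_def by (simp add: pos_less_divide_eq)
  ultimately have "\<bar>Re (l ^ n - l ^ m)\<bar> < e / 2" "\<bar>Im (l ^ n - l ^ m)\<bar> < e / 2"
    by blast+
  then have "cmod (l ^ n - l ^ m) < e"
    using cmod_le[of "l ^ n - l ^ m"] by linarith
  moreover have "l ^ n - l ^ m = l ^ m * (l ^ (n - m) - 1)"
    using mn by (simp add: right_diff_distrib flip: power_add)
  moreover have "cmod l = 1" using L l by auto
  ultimately show "cmod (l ^ (n - m) - 1) < e"
    by (simp add: norm_mult norm_power)
qed

text \<open>An infinite B contains two elements with the same record, and their difference is a
  return time.\<close>

lemma fam_Deltastar_rotation: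
  assumes "finite L" "L \<subseteq> sphere 0 1" "e > 0"
  shows "{n. \<forall>l\<in>L. cmod (l ^ n - 1) < e} \<in> fam_Deltastar"
proof -
  obtain f :: "nat \<Rightarrow> complex \<Rightarrow> int \<times> int" where f: "finite (range f)"
    "\<And>m n l. m \<le> n \<Longrightarrow> f m = f n \<Longrightarrow> l \<in> L \<Longrightarrow> cmod (l ^ (n - m) - 1) < e"
    using rotation_discretisation[OF assms] by metis
  have "{n. \<forall>l\<in>L. cmod (l ^ n - 1) < e} \<inter> {b - a | a b. a \<in> B \<and> b \<in> B \<and> a < b} \<noteq> {}"
    if B: "infinite B" for B
  proof -
    have "\<not> inj_on f B"
      using B f(1) by (meson finite_imageD finite_subset image_mono subset_UNIV)
    then obtain a b where "a \<in> B" "b \<in> B" "a < b" "f a = f b"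
      by (metis inj_onI linorder_neqE_nat)
    with f(2)[of a b] have "b - a \<in> {n. \<forall>l\<in>L. cmod (l ^ n - 1) < e}" by simp
    then show ?thesis using \<open>a \<in> B\<close> \<open>b \<in> B\<close> \<open>a < b\<close> by blast
  qed
  then show ?thesis by (simp add: fam_Deltastar_def)
qed

text \<open>Choose one time for each of the finitely many records, all at most M. Subtracting from n
  + M the chosen time with the same record gives a return time between n and n + M.\<close>

lemma fam_S_rotation:
  assumes "finite L" "L \<subseteq> sphere 0 1" "e > 0"
  shows "{n. \<forall>l\<in>L. cmod (l ^ n - 1) < e} \<in> fam_S"
proof -
  obtain f :: "nat \<Rightarrow> complex \<Rightarrow> int \<times> int" where f: "finite (range f)"
    "\<And>m n l. m \<le> n \<Longrightarrow> f m = f n \<Longrightarrow> l \<in> L \<Longrightarrow> cmod (l ^ (n - m) - 1) < e"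
    using rotation_discretisation[OF assms] by metis
  obtain M where M: "\<And>n. inv f (f n) \<le> M"
    using f(1) by (metis finite_imageI finite_nat_set_iff_bounded_le image_eqI rangeI)
  have "\<exists>k\<in>{n. \<forall>l\<in>L. cmod (l ^ n - 1) < e}. n \<le> k \<and> k < n + Suc M" for n
  proof
    let ?p = "inv f (f (n + M))"
    have "?p \<le> n + M" using M[of "n + M"] by simp
    moreover have "f ?p = f (n + M)" by (simp add: f_inv_into_f)
    ultimately show "n + M - ?p \<in> {n. \<forall>l\<in>L. cmod (l ^ n - 1) < e}"
      using f(2) by blast
    show "n \<le> n + M - ?p \<and> n + M - ?p < n + Suc M"
      using M[of "n + M"] by linarith
  qed
  then show ?thesis unfolding fam_S_def by blast
qed

text \<open>|l^(jd) - 1| is at most j |l^d - 1|, so a sufficiently good return time d has its first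
  k multiples, starting from 0, among the return times.\<close>

lemma fam_AP_rotation:
  assumes L: "finite L" "L \<subseteq> sphere 0 1" and e: "e > 0"
  shows "{n. \<forall>l\<in>L. cmod (l ^ n - 1) < e} \<in> fam_AP"
proof -
  have "\<exists>a d. d > 0 \<and> (\<forall>j<k. a + j * d \<in> {n. \<forall>l\<in>L. cmod (l ^ n - 1) < e})" for k
  proof -
    have "{n. \<forall>l\<in>L. cmod (l ^ n - 1) < e / Suc k} \<in> fam_S"
      using L e by (intro fam_S_rotation) auto
    \<comment> \<open>Time 0 is always a return; syndeticity supplies a positive one to serve as
      common difference.\<close>
    then have "\<exists>d\<in>{n. \<forall>l\<in>L. cmod (l ^ n - 1) < e / Suc k}. 1 \<le> d"
      unfolding fam_S_def by blast
    then obtain d where "d \<ge> 1" and d: "\<And>l. l \<in> L \<Longrightarrow> cmod (l ^ d - 1) < e / Suc k"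
      by blast
    have "cmod (l ^ (j * d) - 1) < e" if j: "j < k" and l: "l \<in> L" for j l
    proof -
      have l1: "cmod l = 1" using l L by auto
      have "cmod (l ^ (j * d) - 1) \<le> j * cmod (l ^ d - 1)"
      proof (induction j)
        case (Suc j)
        have "l ^ (Suc j * d) - 1 = l ^ d * (l ^ (j * d) - 1) + (l ^ d - 1)"
          by (simp add: power_add algebra_simps)
        also have "cmod \<dots> \<le> cmod (l ^ (j * d) - 1) + cmod (l ^ d - 1)"
          by (rule norm_triangle_le) (simp add: norm_mult norm_power l1)
        finally show ?case using Suc by (simp add: algebra_simps)
      qed simp
      also have "\<dots> \<le> j * (e / Suc k)"
        using d[OF l] by (intro mult_left_mono) auto
      also have "\<dots> < e"
        using mult_strict_right_mono[of "real j" "real (Suc k)" e] j e by (simp add: field_simps)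
      finally show ?thesis .
    qed
    then show ?thesis using \<open>d \<ge> 1\<close> by (intro exI[of _ 0] exI[of _ d]) auto
  qed
  then show ?thesis by (simp add: fam_AP_def)
qed

section \<open>Inclusions between the concrete families, infinitude and upward closure\<close>

text \<open>Differences of partial sums of the generators are sums over intervals, so every IP-set
  contains the difference set of an infinite set.\<close>

lemma fam_Deltastar_subset_fam_IPstar: "fam_Deltastar \<subseteq> fam_IPstar"
proof
  fix A assume A: "A \<in> fam_Deltastar"
  have "A \<inter> IP_set n \<noteq> {}" if n: "\<forall>k. n k \<ge> 1" for n
  proof -
    define s where "s i = (\<Sum>k<i. n k)" for i
    have mono: "strict_mono s"
      unfolding strict_mono_Suc_iff s_def using n by (simp add: Suc_le_eq)
    then have "infinite (range s)"
      using finite_imageD strict_mono_imp_inj_on infinite_UNIV_nat by blast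
    then obtain i j where ij: "s i < s j" "s j - s i \<in> A"
      using A unfolding fam_Deltastar_def by blast
    then have "i < j" using mono by (simp add: strict_mono_less)
    then have "s j = s i + (\<Sum>k\<in>{i..<j}. n k)"
      unfolding s_def lessThan_atLeast0 by (simp add: sum.atLeastLessThan_concat)
    then have "s j - s i = (\<Sum>k\<in>{i..<j}. n k)" by simp
    moreover have "(\<Sum>k\<in>{i..<j}. n k) \<in> IP_set n"
      using \<open>i < j\<close> unfolding IP_set_def by (intro CollectI exI[of _ "{i..<j}"]) auto
    ultimately show ?thesis using ij by auto
  qed
  then show "A \<in> fam_IPstar" by (simp add: fam_IPstar_def)
qed

text \<open>A set bounded by M misses the IP-set generated by the constant M + 1.\<close>

lemma fam_IPstar_infinite:
  assumes "A \<in> fam_IPstar"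
  shows "infinite A"
proof
  assume "finite A"
  then obtain M where M: "\<And>a. a \<in> A \<Longrightarrow> a \<le> M"
    using finite_nat_set_iff_bounded_le by auto
  obtain x where x: "x \<in> A" "x \<in> IP_set (\<lambda>_. Suc M)"
    using assms unfolding fam_IPstar_def by force
  then obtain G :: "nat set" where G: "finite G" "G \<noteq> {}" "x = card G * Suc M"
    by (auto simp: IP_set_def)
  then have "card G > 0" by (simp add: card_gt_0_iff)
  then have "x \<ge> Suc M" using G by (cases "card G") auto
  with M x show False by fastforce
qed

text \<open>A progression with M + 2 terms and positive difference reaches beyond M.\<close>

lemma fam_AP_infinite:
  assumes "A \<in> fam_AP"
  shows "infinite A"
proof
  assume "finite A"
  then obtain M where M: "\<And>a. a \<in> A \<Longrightarrow> a \<le> M"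
    using finite_nat_set_iff_bounded_le by auto
  obtain a d where "d > 0" "\<forall>j<Suc (Suc M). a + j * d \<in> A"
    using assms unfolding fam_AP_def by blast
  then have "a + Suc M * d \<le> M" using M by blast
  moreover have "Suc M * 1 \<le> Suc M * d" using \<open>d > 0\<close> by (intro mult_le_mono) auto
  ultimately show False by (simp only: mult_1_right)
qed

text \<open>Each block of m consecutive integers meets A. The bound 1/(2m) in place of 1/m absorbs
  the incomplete last block as soon as N is at least 2m.\<close>

lemma fam_S_subset_fam_lD: "fam_S \<subseteq> fam_lD"
proof
  fix A assume "A \<in> fam_S"
  then obtain m where m: "\<And>n. \<exists>k\<in>A. n \<le> k \<and> k < n + m"
    by (auto simp: fam_S_def)
  have m0: "m > 0" using m[of 0] by auto
  have blocks: "q \<le> card (A \<inter> {..<q * m})" for q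
  proof (induction q)
    case (Suc q)
    obtain k where k: "k \<in> A" "q * m \<le> k" "k < q * m + m" using m by blast
    have "Suc q \<le> card (insert k (A \<inter> {..<q * m}))"
      using Suc k by simp
    also have "\<dots> \<le> card (A \<inter> {..<Suc q * m})"
      using k by (intro card_mono) auto
    finally show ?case .
  qed simp
  have "ereal (1 / (2 * m)) \<le> ereal (card (A \<inter> {..<N}) / N)" if N: "N \<ge> 2 * m" for N
  proof -
    have "N div m \<le> card (A \<inter> {..<N div m * m})" by (rule blocks)
    also have "\<dots> \<le> card (A \<inter> {..<N})"
      by (intro card_mono) (auto intro: less_le_trans)
    finally have "real (N div m) \<le> card (A \<inter> {..<N})" by simp
    moreover have "real N / m - 1 \<le> real (N div m)"
      using floor_divide_of_nat_eq[of N m, where ?'a = real] floor_correct[of "real N / m"]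
      by linarith
    moreover have "real N / (2 * m) \<ge> 1" using N m0 by (simp add: field_simps)
    ultimately have "real N / (2 * m) \<le> card (A \<inter> {..<N})"
      by (simp add: field_simps)
    moreover have "real N > 0" using N m0 by simp
    ultimately show ?thesis by (simp add: field_simps)
  qed
  then have "ereal (1 / (2 * m)) \<le> lower_density A"
    unfolding lower_density_def
    by (intro Liminf_bounded) (auto simp: eventually_sequentially)
  moreover have "0 < ereal (1 / (2 * m))" using m0 by simp
  ultimately show "A \<in> fam_lD"
    unfolding fam_lD_def using less_le_trans by blast
qed

lemma fam_lD_subset_fam_uD: "fam_lD \<subseteq> fam_uD"
  unfolding fam_lD_def fam_uD_def lower_density_def upper_density_def
  using less_le_trans[OF _ Liminf_le_Limsup[OF sequentially_bot]] by blast

lemma fam_uD_subset_fam_BD: "fam_uD \<subseteq> fam_BD"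
proof -
  have "upper_density A \<le> upper_Banach_density A" for A
    unfolding upper_density_def upper_Banach_density_def
  proof (intro Limsup_mono always_eventually allI)
    fix N
    show "ereal (card (A \<inter> {..<N}) / N) \<le> (SUP m. ereal (card (A \<inter> {m..<m + N}) / N))"
      by (rule SUP_upper2[of 0]) (auto simp: atLeast0LessThan)
  qed
  then show ?thesis
    unfolding fam_uD_def fam_BD_def by (auto intro: less_le_trans)
qed

text \<open>For finite A the windows of length N have density at most \<open>card A / N\<close>,
  uniformly in their position.\<close>

lemma fam_BD_infinite:
  assumes "A \<in> fam_BD"
  shows "infinite A"
proof
  assume fin: "finite A"
  have "upper_Banach_density A \<le> limsup (\<lambda>N. ereal (card A / N))"
    unfolding upper_Banach_density_def
  proof (intro Limsup_mono always_eventually allI SUP_least)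
    fix N m
    show "ereal (card (A \<inter> {m..<m + N}) / N) \<le> ereal (card A / N)"
      using fin by (auto intro!: divide_right_mono card_mono)
  qed
  also have "(\<lambda>N. ereal (card A / N)) \<longlonglongrightarrow> ereal 0"
    by (intro tendsto_ereal lim_const_over_n)
  then have "limsup (\<lambda>N. ereal (card A / N)) = ereal 0"
    by (rule lim_imp_Limsup[OF sequentially_bot])
  finally show False using assms by (simp add: fam_BD_def zero_ereal_def)
qed

lemma density_mono:
  assumes "A \<subseteq> B"
  shows lower_density_mono: "lower_density A \<le> lower_density B"
    and upper_density_mono: "upper_density A \<le> upper_density B"
    and upper_Banach_density_mono: "upper_Banach_density A \<le> upper_Banach_density B"
proof -
  have le: "ereal (card (A \<inter> I) / N) \<le> ereal (card (B \<inter> I) / N)" if "finite I" for I and N :: nat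
    using that assms by (auto intro!: divide_right_mono card_mono)
  show "lower_density A \<le> lower_density B"
    unfolding lower_density_def by (intro Liminf_mono always_eventually allI le) simp
  show "upper_density A \<le> upper_density B"
    unfolding upper_density_def by (intro Limsup_mono always_eventually allI le) simp
  show "upper_Banach_density A \<le> upper_Banach_density B"
    unfolding upper_Banach_density_def
    by (intro Limsup_mono always_eventually allI SUP_mono' le) simp
qed

lemma fam_upward_closed:
  assumes "F \<in> {fam_I, fam_AP, fam_BD, fam_uD, fam_lD, fam_S, fam_IPstar, fam_Deltastar}"
    and "A \<in> F" "A \<subseteq> B"
  shows "B \<in> F"
proof -
  have "A \<in> fam_I \<Longrightarrow> B \<in> fam_I"
    unfolding fam_I_def using infinite_super[OF assms(3)] by simp
  moreover have "A \<in> fam_AP \<Longrightarrow> B \<in> fam_AP"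
    unfolding fam_AP_def mem_Collect_eq by (meson assms(3) subsetD)
  moreover have "A \<in> fam_BD \<Longrightarrow> B \<in> fam_BD"
    using less_le_trans[OF _ upper_Banach_density_mono[OF assms(3)]] by (simp add: fam_BD_def)
  moreover have "A \<in> fam_uD \<Longrightarrow> B \<in> fam_uD"
    using less_le_trans[OF _ upper_density_mono[OF assms(3)]] by (simp add: fam_uD_def)
  moreover have "A \<in> fam_lD \<Longrightarrow> B \<in> fam_lD"
    using less_le_trans[OF _ lower_density_mono[OF assms(3)]] by (simp add: fam_lD_def)
  moreover have "A \<in> fam_S \<Longrightarrow> B \<in> fam_S"
    unfolding fam_S_def using assms(3) by blast
  moreover have "A \<in> fam_IPstar \<Longrightarrow> B \<in> fam_IPstar"
    unfolding fam_IPstar_def using assms(3) by blast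
  moreover have "A \<in> fam_Deltastar \<Longrightarrow> B \<in> fam_Deltastar"
    unfolding fam_Deltastar_def using assms(3) by blast
  ultimately show ?thesis using assms(1,2) by blast
qed

text \<open>The inclusions reduce the work: infinitude is checked on the largest families,
  membership of the return times on the smallest.\<close>

lemma fam_rotation_family:
  assumes F: "F \<in> {fam_I, fam_AP, fam_BD, fam_uD, fam_lD, fam_S, fam_IPstar, fam_Deltastar}"
  shows "rotation_family F"
  unfolding rotation_family_def
proof (intro conjI ballI allI impI)
  note subs = fam_S_subset_fam_lD fam_lD_subset_fam_uD fam_uD_subset_fam_BD
    fam_Deltastar_subset_fam_IPstar
  fix A assume "A \<in> F"
  then have "A \<in> fam_I \<or> A \<in> fam_AP \<or> A \<in> fam_BD \<or> A \<in> fam_IPstar"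
    using F subs by blast
  then show "infinite A"
    using fam_AP_infinite fam_BD_infinite fam_IPstar_infinite by (auto simp: fam_I_def)
next
  fix A B assume "A \<in> F" "A \<subseteq> B"
  then show "B \<in> F" using fam_upward_closed[OF F] by blast
next
  fix L :: "complex set" and e :: real
  assume L: "finite L \<and> L \<subseteq> sphere 0 1 \<and> e > 0"
  have "{n. \<forall>l\<in>L. cmod (l ^ n - 1) < e} \<in> fam_S \<inter> fam_AP \<inter> fam_Deltastar"
    using L fam_S_rotation fam_AP_rotation fam_Deltastar_rotation by blast
  moreover have "fam_BD \<subseteq> fam_I"
    using fam_BD_infinite by (auto simp: fam_I_def)
  ultimately show "{n. \<forall>l\<in>L. cmod (l ^ n - 1) < e} \<in> F"
    using F fam_S_subset_fam_lD fam_lD_subset_fam_uD fam_uD_subset_fam_BD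
      fam_Deltastar_subset_fam_IPstar by blast
qed

section \<open>The space of all real sequences as a separable F-space\<close>

definition real_seq_space :: "(nat \<Rightarrow> real) fspace" where
  "real_seq_space = \<lparr>fcarrier = UNIV, vadd = \<lambda>x y i. x i + y i, vzero = \<lambda>_. 0,
     vscale = \<lambda>c x i. Re c * x i, scalars = \<real>, vdist = dist\<rparr>"

lemma real_seq_space_simps [simp]:
  "fcarrier real_seq_space = UNIV" "vadd real_seq_space = (\<lambda>x y i. x i + y i)"
  "vzero real_seq_space = (\<lambda>_. 0)" "vscale real_seq_space = (\<lambda>c x i. Re c * x i)"
  "scalars real_seq_space = \<real>" "vdist real_seq_space = dist"
  by (simp_all add: real_seq_space_def)

lemma ftop_real_seq_space [simp]: "ftop real_seq_space = euclidean"
  by (simp add: ftop_def)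

lemma infinite_dimensional_real_seq_space: "infinite_dimensional real_seq_space UNIV"
  unfolding infinite_dimensional_def
proof
  assume "\<exists>B. finite B \<and> B \<subseteq> UNIV \<and> UNIV \<subseteq> vspan real_seq_space B"
  then obtain B where B: "finite B" "UNIV \<subseteq> vspan real_seq_space B" by blast
  \<comment> \<open>Everything in the span of \<open>B\<close> is bounded by a multiple of \<open>s\<close>, but \<open>\<lambda>i. i * (1 + s i)\<close> is not.\<close>
  define s where "s i = (\<Sum>f\<in>B. \<bar>f i\<bar>)" for i
  have s0: "s i \<ge> 0" for i by (simp add: s_def sum_nonneg)
  have "\<exists>C. \<forall>i. \<bar>lincomb real_seq_space cs i\<bar> \<le> C * s i" if "set cs \<subseteq> \<real> \<times> B" for cs
    using that
  proof (induction cs)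
    case (Cons p cs)
    then obtain C where C: "\<And>i. \<bar>lincomb real_seq_space cs i\<bar> \<le> C * s i" by auto
    have "\<bar>snd p i\<bar> \<le> s i" for i
      unfolding s_def using Cons.prems B by (intro member_le_sum) auto
    then have "\<bar>Re (fst p) * snd p i\<bar> \<le> \<bar>Re (fst p)\<bar> * s i" for i
      unfolding abs_mult by (intro mult_left_mono) auto
    then have "\<bar>lincomb real_seq_space (p # cs) i\<bar> \<le> (\<bar>Re (fst p)\<bar> + C) * s i" for i
      using C[of i] unfolding distrib_right by (simp add: abs_le_iff) (smt (verit))
    then show ?case by blast
  qed (auto intro: exI[of _ 0])
  moreover obtain cs where "set cs \<subseteq> \<real> \<times> B" "(\<lambda>i. real i * (1 + s i)) = lincomb real_seq_space cs"
    using subsetD[OF B(2), of "\<lambda>i. real i * (1 + s i)"] unfolding vspan_def by auto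
  ultimately obtain C where C: "\<And>i. \<bar>real i * (1 + s i)\<bar> \<le> C * s i" by metis
  obtain i where i: "real i > \<bar>C\<bar>" using reals_Archimedean2 by blast
  have "C * s i \<le> real i * s i" using i s0 by (intro mult_right_mono) auto
  then show False using C[of i] i s0[of i] by (simp add: algebra_simps)
qed

lemma sep_inf_F_space_real_seq_space: "sep_inf_F_space real_seq_space"
  unfolding sep_inf_F_space_def F_space_def
proof (intro conjI)
  show "vector_space_on real_seq_space"
    unfolding vector_space_on_def
    by (auto simp: algebra_simps complex_is_Real_iff fun_eq_iff intro: exI[of _ "\<lambda>i. - _ i"])
  show "Metric_space (fcarrier real_seq_space) (vdist real_seq_space)"
    using Met_TC.Metric_space_axioms by simp
  show "Metric_space.mcomplete (fcarrier real_seq_space) (vdist real_seq_space)"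
    by (simp add: mcomplete_iff_complete complete_UNIV)
  \<comment> \<open>The metric is a weighted sum of truncated coordinate distances, each of them
    translation invariant.\<close>
  show "\<forall>x\<in>fcarrier real_seq_space. \<forall>y\<in>fcarrier real_seq_space. \<forall>z\<in>fcarrier real_seq_space.
      vdist real_seq_space (vadd real_seq_space x z) (vadd real_seq_space y z) = vdist real_seq_space x y"
    by (simp add: dist_fun_def)
  show "continuous_map (prod_topology (ftop real_seq_space) (ftop real_seq_space))
      (ftop real_seq_space) (\<lambda>(x, y). vadd real_seq_space x y)"
    by (simp add: split_beta)
      (intro continuous_on_coordinatewise_then_product continuous_on_add
        continuous_on_product_then_coordinatewise[OF continuous_on_fst]
        continuous_on_product_then_coordinatewise[OF continuous_on_snd] continuous_on_id)
  show "continuous_map (prod_topology (top_of_set (scalars real_seq_space)) (ftop real_seq_space))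
      (ftop real_seq_space) (\<lambda>(c, x). vscale real_seq_space c x)"
    by (simp add: split_beta prod_topology_subtopology)
      (intro continuous_on_coordinatewise_then_product continuous_on_mult continuous_on_Re
        continuous_on_product_then_coordinatewise[OF continuous_on_snd] continuous_on_fst continuous_on_id)
  show "separable_space real_seq_space"
  proof -
    obtain D :: "(nat \<Rightarrow> real) set" where D: "countable D" "\<And>U. open U \<Longrightarrow> U \<noteq> {} \<Longrightarrow> \<exists>d\<in>D. d \<in> U"
      using countable_dense_exists by blast
    then have "closure D = UNIV"
      by (auto simp: closure_iff_nhds_not_empty) blast
    then show ?thesis
      using D(1) by (auto simp: separable_space_def closure_of_UNIV)
  qed
  show "infinite_dimensional real_seq_space (fcarrier real_seq_space)"
    using infinite_dimensional_real_seq_space by simp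
qed

section \<open>Rotations of coordinate planes and the eigenvector hypothesis\<close>

definition cx_coord :: "(nat \<Rightarrow> real) \<Rightarrow> nat \<Rightarrow> complex" where
  "cx_coord x k = Complex (x (2 * k)) (x (2 * k + 1))"

text \<open>A diagonal complex operator written over the reals: on the plane of coordinates 2k and
  2k + 1 it is multiplication by \<open>l k\<close>.\<close>

definition rotation_op :: "(nat \<Rightarrow> complex) \<Rightarrow> (nat \<Rightarrow> real) \<Rightarrow> nat \<Rightarrow> real" where
  "rotation_op l x i = (let z = l (i div 2) * cx_coord x (i div 2) in if even i then Re z else Im z)"

lemma cx_coord_rotation_op: "cx_coord (rotation_op l x) k = l k * cx_coord x k"
  by (simp add: cx_coord_def rotation_op_def Let_def complex_eq_iff)

lemma cx_coord_funpow: "cx_coord ((rotation_op l ^^ n) x) k = l k ^ n * cx_coord x k"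
  by (induction n) (simp_all add: cx_coord_rotation_op)

lemma continuous_cx_coord: "continuous_on UNIV (\<lambda>x. cx_coord x k)"
  unfolding cx_coord_def Complex_eq
  by (intro continuous_intros continuous_on_product_then_coordinatewise[OF continuous_on_id])

lemma cont_lin_op_rotation_op: "cont_lin_op real_seq_space (rotation_op l)"
proof -
  have "continuous_on UNIV (\<lambda>x. rotation_op l x i)" for i
    unfolding rotation_op_def Let_def
    by (cases "even i") (simp_all add: continuous_on_Re continuous_on_Im continuous_on_mult
        continuous_cx_coord del: times_complex.sel)
  then have "continuous_on UNIV (rotation_op l)"
    by (rule continuous_on_coordinatewise_then_product)
  moreover have "rotation_op l (\<lambda>i. x i + y i) = (\<lambda>i. rotation_op l x i + rotation_op l y i)" for x y
    by (rule ext) (simp add: rotation_op_def cx_coord_def Let_def algebra_simps)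
  moreover have "rotation_op l (\<lambda>i. a * x i) = (\<lambda>i. a * rotation_op l x i)" for a x
    by (rule ext) (simp add: rotation_op_def cx_coord_def Let_def algebra_simps)
  ultimately show ?thesis by (simp add: cont_lin_op_def)
qed

lemma rotation_op_eigenvector:
  assumes "cmod (l k) = 1"
  shows "(\<lambda>i. if i = 2 * k then 1 else 0) \<in> unimod_eigenvectors real_seq_space (rotation_op l)"
proof -
  \<comment> \<open>In the complexification, (1, -i) is the eigenvector of multiplication by
    \<open>l k\<close> on the plane; the opposite sign would belong to the conjugate
    eigenvalue.\<close>
  let ?x = "\<lambda>i. if i = 2 * k then 1 else 0 :: real" and ?y = "\<lambda>i. if i = 2 * k + 1 then - 1 else 0 :: real"
  have "\<i> \<notin> \<real>" by (simp add: complex_is_Real_iff)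
  then have R: "(\<real> :: complex set) \<noteq> UNIV" by blast
  have "rotation_op l ?x i = Re (l k) * ?x i + - Im (l k) * ?y i"
    "rotation_op l ?y i = Im (l k) * ?x i + Re (l k) * ?y i" for i
  proof -
    obtain m where "i = 2 * m \<or> i = 2 * m + 1" using evenE oddE by metis
    moreover have "2 * m \<noteq> Suc (2 * k)" "Suc (2 * m) \<noteq> 2 * k" by presburger+
    moreover have "cx_coord ?x m = (if m = k then 1 else 0)" "cx_coord ?y m = (if m = k then - \<i> else 0)"
      using calculation(2,3) by (simp_all add: cx_coord_def complex_eq_iff)
    ultimately show "rotation_op l ?x i = Re (l k) * ?x i + - Im (l k) * ?y i"
      "rotation_op l ?y i = Im (l k) * ?x i + Re (l k) * ?y i"
      by (cases "m = k"; auto simp: rotation_op_def)+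
  qed
  then have "cx_op (rotation_op l) (?x, ?y) = cx_scale real_seq_space (l k) (?x, ?y)"
    by (simp add: cx_op_def cx_scale_def fun_eq_iff)
  moreover have "(?x, ?y) \<noteq> (vzero real_seq_space, vzero real_seq_space)"
    by (auto simp: fun_eq_iff)
  ultimately have "\<exists>y\<in>fcarrier real_seq_space. (?x, y) \<noteq> (vzero real_seq_space, vzero real_seq_space) \<and>
      (\<exists>z. cmod z = 1 \<and> cx_op (rotation_op l) (?x, y) = cx_scale real_seq_space z (?x, y))"
    using assms by (intro bexI[of _ ?y] conjI exI[of _ "l k"]) simp_all
  then show ?thesis
    using R by (simp add: unimod_eigenvectors_def)
qed

text \<open>Let each l in L rotate a plane of its own. The sum v of one eigenvector per plane is
  recurrent by hypothesis, and its orbit displays the powers l^n in the complex coordinates.\<close>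

lemma eigen_hyp_rotation:
  assumes F: "eigen_hyp F" and up: "\<forall>A\<in>F. \<forall>B. A \<subseteq> B \<longrightarrow> B \<in> F"
    and L: "finite L" "L \<subseteq> sphere 0 1" and e: "e > 0"
  shows "{n. \<forall>l\<in>L. cmod (l ^ n - 1) < e} \<in> F"
proof -
  obtain ls where ls: "set ls = L" using finite_list[OF L(1)] by blast
  let ?m = "length ls"
  \<comment> \<open>The default 1 fixes the remaining planes and keeps every \<open>l k\<close>
    unimodular.\<close>
  define l where "l k = (if k < ?m then ls ! k else 1)" for k
  have l: "cmod (l k) = 1" for k
    using subsetD[OF L(2), of "ls ! k"] ls by (auto simp: l_def)
  define unit where "unit k = (\<lambda>i. if i = 2 * k then 1 else 0 :: real)" for k :: nat
  define v where "v = lincomb real_seq_space (map (\<lambda>k. (1, unit k)) [0..<?m])"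
  have "lincomb real_seq_space (map (\<lambda>k. (1, unit k)) ks) =
      (\<lambda>i. if even i \<and> i div 2 \<in> set ks then 1 else 0)" if "distinct ks" for ks
    using that by (induction ks) (auto simp: unit_def fun_eq_iff)
  then have "cx_coord v k = (if k < ?m then 1 else 0)" for k
    by (simp add: v_def cx_coord_def complex_eq_iff)
  then have orbit: "cx_coord ((rotation_op l ^^ n) v) k = ls ! k ^ n" if "k < ?m" for n k
    using that by (simp add: cx_coord_funpow l_def)
  have "v \<in> vspan real_seq_space (unimod_eigenvectors real_seq_space (rotation_op l))"
    unfolding v_def vspan_def
  proof (intro CollectI exI conjI)
    show "set (map (\<lambda>k. (1, unit k)) [0..<?m]) \<subseteq>
        scalars real_seq_space \<times> unimod_eigenvectors real_seq_space (rotation_op l)"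
      using rotation_op_eigenvector[of l] l by (auto simp: unit_def)
  qed simp
  then have v: "v \<in> frec F euclidean (rotation_op l)"
    using F[unfolded eigen_hyp_def, rule_format, OF conjI[OF sep_inf_F_space_real_seq_space
        cont_lin_op_rotation_op[of l]]] by auto
  \<comment> \<open>Only finitely many coordinates are constrained, so U is open; returning to it
    means that all l^n are close to 1.\<close>
  define U where "U = (\<Inter>k\<in>{..<?m}. {x. cmod (cx_coord x k - 1) < e})"
  have "open U"
    unfolding U_def
    by (intro open_INT ballI open_Collect_less continuous_intros continuous_cx_coord) auto
  moreover have "v \<in> U"
    using orbit[of _ 0] e by (simp add: U_def)
  ultimately have "{n. (rotation_op l ^^ n) v \<in> U} \<in> F"
    using v by (simp add: frec_def)
  moreover have "{n. (rotation_op l ^^ n) v \<in> U} \<subseteq> {n. \<forall>l\<in>L. cmod (l ^ n - 1) < e}"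
    unfolding U_def ls[symmetric] by (auto simp: orbit in_set_conv_nth)
  ultimately show ?thesis using up by blast
qed

section \<open>Recurrent subspaces\<close>

text \<open>A single gauge g controls all N coordinates, so no members of F have to be intersected.
  If no sublevel set of g returned to U, times with g tending to 0 would stay outside U, against
  coordinatewise convergence.\<close>

lemma frec_pow_if_limitin:
  assumes up: "\<forall>A\<in>F. \<forall>B. A \<subseteq> B \<longrightarrow> B \<in> F"
    and z: "z \<in> PiE {..<N} (\<lambda>_. topspace (ftop E))"
    and T: "\<And>x. x \<in> topspace (ftop E) \<Longrightarrow> T x \<in> topspace (ftop E)"
    and g: "\<And>n. (0::real) \<le> g n" and small: "\<And>e. e > 0 \<Longrightarrow> {n. g n < e} \<in> F"
    and lim: "\<And>i n. i < N \<Longrightarrow> (\<lambda>k. g (n k)) \<longlonglongrightarrow> 0 \<Longrightarrow>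
                limitin (ftop E) (\<lambda>k. (T ^^ n k) (z i)) (z i) sequentially"
  shows "z \<in> frec F (pow_top E N) (diag_op T N)"
  unfolding frec_def
proof (intro CollectI conjI allI impI)
  show "z \<in> topspace (pow_top E N)"
    using z by (simp add: pow_top_def)
next
  fix U assume U: "openin (pow_top E N) U \<and> z \<in> U"
  have Tn: "(T ^^ n) x \<in> topspace (ftop E)" if "x \<in> topspace (ftop E)" for n x
    using that T by (induction n) auto
  \<comment> \<open>At n = 0 this uses that z, as an element of \<open>PiE\<close>, is
    extensional.\<close>
  have diag: "(diag_op T N ^^ n) z = restrict (\<lambda>i. (T ^^ n) (z i)) {..<N}" for n
    using z by (induction n) (auto simp: diag_op_def PiE_def extensional_def restrict_def)
  have "\<exists>e>0. \<forall>n. g n < e \<longrightarrow> (diag_op T N ^^ n) z \<in> U"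
  proof (rule ccontr)
    assume "\<not> ?thesis"
    then have "\<forall>k. \<exists>n. g n < inverse (real (Suc k)) \<and> (diag_op T N ^^ n) z \<notin> U"
      by (meson inverse_positive_iff_positive of_nat_0_less_iff zero_less_Suc)
    then obtain n where n: "\<And>k. g (n k) < inverse (real (Suc k))"
      and nU: "\<And>k. (diag_op T N ^^ n k) z \<notin> U" by metis
    have "(\<lambda>k. g (n k)) \<longlonglongrightarrow> 0"
      by (rule tendsto_sandwich[OF _ _ tendsto_const LIMSEQ_inverse_real_of_nat])
        (use g less_imp_le[OF n] in \<open>auto intro!: always_eventually simp del: of_nat_Suc\<close>)
    then have "limitin (pow_top E N) (\<lambda>k. (diag_op T N ^^ n k) z) z sequentially"
      using z lim Tn unfolding pow_top_def diag
      by (auto simp: limitin_componentwise PiE_iff)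
    then have "\<forall>\<^sub>F k in sequentially. (diag_op T N ^^ n k) z \<in> U"
      using U by (auto simp: limitin_def)
    then show False
      using nU by (auto dest: eventually_happens)
  qed
  then show "{n. (diag_op T N ^^ n) z \<in> U} \<in> F"
    using small up by (meson Collect_mono)
qed

lemma vspan_subset:
  assumes "vsubspace E Z" "B \<subseteq> Z"
  shows "vspan E B \<subseteq> Z"
proof -
  have "lincomb E cs \<in> Z" if "set cs \<subseteq> scalars E \<times> B" for cs
    using that assms by (induction cs) (auto simp: vsubspace_def)
  then show ?thesis by (auto simp: vspan_def)
qed

text \<open>The map \<open>j\<close> embeds the given space into its complexification, and is the identity if the space
  is complex.\<close>
locale conv_ext = conv_op +
  fixes E :: "'v fspace" and T :: "'v \<Rightarrow> 'v" and j :: "'v \<Rightarrow> 'a"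
  assumes F_space: "F_space E" and T: "cont_lin_op E T"
    and j_in [simp]: "x \<in> fcarrier E \<Longrightarrow> j x \<in> C"
    and j_zero: "j (vzero E) = zero"
    and j_add: "x \<in> fcarrier E \<Longrightarrow> y \<in> fcarrier E \<Longrightarrow> j (vadd E x y) = add (j x) (j y)"
    and j_scale: "c \<in> scalars E \<Longrightarrow> x \<in> fcarrier E \<Longrightarrow> j (vscale E c x) = sc c (j x)"
    and j_T: "x \<in> fcarrier E \<Longrightarrow> j (T x) = S (j x)"
    and j_conv: "(\<And>n. u n \<in> fcarrier E) \<Longrightarrow> x \<in> fcarrier E \<Longrightarrow>
        conv (\<lambda>n. j (u n)) (j x) \<longleftrightarrow> limitin (ftop E) u x sequentially"
begin

sublocale M: Metric_space "fcarrier E" "vdist E"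
  using F_space by (simp add: F_space_def)

lemma ftop_eq: "ftop E = M.mtopology"
  by (simp add: ftop_def)

lemma topspace_ftop [simp]: "topspace (ftop E) = fcarrier E"
  by (simp add: ftop_eq)

lemma vs: "vector_space_on E"
  using F_space by (simp add: F_space_def)

lemma carrier_closed [simp]:
  "vzero E \<in> fcarrier E"
  "x \<in> fcarrier E \<Longrightarrow> y \<in> fcarrier E \<Longrightarrow> vadd E x y \<in> fcarrier E"
  "c \<in> scalars E \<Longrightarrow> x \<in> fcarrier E \<Longrightarrow> vscale E c x \<in> fcarrier E"
  using vs by (auto simp: vector_space_on_def)

lemma T_in [simp]: "x \<in> fcarrier E \<Longrightarrow> T x \<in> fcarrier E"
  using T by (simp add: cont_lin_op_def)

lemma T_funpow_in [simp]: "x \<in> fcarrier E \<Longrightarrow> (T ^^ n) x \<in> fcarrier E"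
  by (induction n) auto

lemma j_funpow: "x \<in> fcarrier E \<Longrightarrow> j ((T ^^ n) x) = (S ^^ n) (j x)"
  by (induction n) (auto simp: j_T)

lemma scalars_closed [simp]:
  "0 \<in> scalars E" "1 \<in> scalars E"
  "c \<in> scalars E \<Longrightarrow> d \<in> scalars E \<Longrightarrow> c + d \<in> scalars E"
  "c \<in> scalars E \<Longrightarrow> d \<in> scalars E \<Longrightarrow> c * d \<in> scalars E"
  using vs by (auto simp: vector_space_on_def)

lemma limitin_orbit_iff:
  assumes "x \<in> fcarrier E"
  shows "limitin (ftop E) (\<lambda>k. (T ^^ n k) x) x sequentially \<longleftrightarrow> conv (\<lambda>k. (S ^^ n k) (j x)) (j x)"
  using j_conv[of "\<lambda>k. (T ^^ n k) x" x] assms by (simp add: j_funpow)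

lemma limitin_orbit_iff_dist:
  assumes "x \<in> fcarrier E"
  shows "limitin (ftop E) (\<lambda>k. (T ^^ n k) x) x sequentially \<longleftrightarrow>
    (\<lambda>k. vdist E ((T ^^ n k) x) x) \<longlonglongrightarrow> 0"
  using assms by (simp add: ftop_eq M.limitin_metric_dist_null)

section \<open>Polynomial orbits of a vector\<close>

text \<open>Complex polynomials act after applying \<open>j\<close>, which treats both scalar fields
  at once. The parameter Q allows a bound on the degree as well as all polynomials over the
  scalars.\<close>

definition orbit_poly :: "complex poly set \<Rightarrow> 'v \<Rightarrow> 'v set" where
  "orbit_poly Q x = {z \<in> fcarrier E. \<exists>p\<in>Q. j z = act p (j x)}"

lemma vsubspace_orbit_poly:
  assumes "x \<in> fcarrier E" "0 \<in> Q" "\<And>p q. p \<in> Q \<Longrightarrow> q \<in> Q \<Longrightarrow> p + q \<in> Q"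
    "\<And>c p. c \<in> scalars E \<Longrightarrow> p \<in> Q \<Longrightarrow> smult c p \<in> Q"
  shows "vsubspace E (orbit_poly Q x)"
  unfolding vsubspace_def
proof (intro conjI ballI)
  show "vzero E \<in> orbit_poly Q x"
    using assms by (auto simp: orbit_poly_def j_zero intro!: bexI[of _ 0])
next
  fix y z assume "y \<in> orbit_poly Q x" "z \<in> orbit_poly Q x"
  then obtain p q where "p \<in> Q" "q \<in> Q" "j y = act p (j x)" "j z = act q (j x)"
    and "y \<in> fcarrier E" "z \<in> fcarrier E" by (auto simp: orbit_poly_def)
  then show "vadd E y z \<in> orbit_poly Q x"
    using assms by (auto simp: orbit_poly_def j_add act_add intro!: bexI[of _ "p + q"])
next
  fix c y assume "c \<in> scalars E" "y \<in> orbit_poly Q x"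
  moreover then obtain p where "p \<in> Q" "j y = act p (j x)" "y \<in> fcarrier E"
    by (auto simp: orbit_poly_def)
  ultimately show "vscale E c y \<in> orbit_poly Q x"
    using assms by (auto simp: orbit_poly_def j_scale act_smult intro!: bexI[of _ "smult c p"])
qed (auto simp: orbit_poly_def)

abbreviation scalar_polys :: "complex poly set" where
  "scalar_polys \<equiv> {p. \<forall>i. coeff p i \<in> scalars E}"

text \<open>A finite spanning set involves only degrees up to some d, so T^(d+1) x equals p(T) x
  with p of degree at most d; then X^(d+1) - p is an annihilator.\<close>

lemma orbit_poly_finite_dim:
  assumes x: "x \<in> fcarrier E"
    and fin: "\<not> infinite_dimensional E (orbit_poly scalar_polys x)"
  obtains p where "p \<noteq> 0" "act p (j x) = zero"
proof -
  obtain B where B: "finite B" "B \<subseteq> orbit_poly scalar_polys x"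
    "orbit_poly scalar_polys x \<subseteq> vspan E B"
    using fin by (auto simp: infinite_dimensional_def)
  then have "\<forall>b\<in>B. \<exists>p. p \<in> scalar_polys \<and> j b = act p (j x)"
    by (auto simp: orbit_poly_def)
  then obtain q where q: "\<And>b. b \<in> B \<Longrightarrow> q b \<in> scalar_polys \<and> j b = act (q b) (j x)"
    by metis
  \<comment> \<open>The inserted 0 keeps \<open>Max\<close> meaningful for empty B.\<close>
  define d where "d = Max (insert 0 ((degree \<circ> q) ` B))"
  define Q where "Q = scalar_polys \<inter> {p. degree p \<le> d}"
  have d: "degree (q b) \<le> d" if "b \<in> B" for b
    unfolding d_def using that B by (intro Max_ge) auto
  have "vsubspace E (orbit_poly Q x)"
  proof (rule vsubspace_orbit_poly[OF x])
    show "smult c p \<in> Q" if "c \<in> scalars E" "p \<in> Q" for c p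
      using that order.trans[OF degree_smult_le] by (auto simp: Q_def)
  qed (auto simp: Q_def intro: degree_add_le)
  moreover have "B \<subseteq> orbit_poly Q x"
    using B q d by (auto simp: orbit_poly_def Q_def intro!: bexI[of _ "q _"])
  ultimately have "orbit_poly scalar_polys x \<subseteq> orbit_poly Q x"
    using B vspan_subset by blast
  moreover have "(T ^^ Suc d) x \<in> orbit_poly scalar_polys x"
    unfolding orbit_poly_def
  proof (intro CollectI conjI bexI)
    show "j ((T ^^ Suc d) x) = act (monom 1 (Suc d)) (j x)"
      using x by (simp only: j_funpow act_monom j_in)
  qed (use x in auto)
  ultimately have "(T ^^ Suc d) x \<in> orbit_poly Q x" by (rule subsetD)
  then obtain p where p: "degree p \<le> d" "j ((T ^^ Suc d) x) = act p (j x)"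
    unfolding orbit_poly_def Q_def by blast
  let ?r = "monom 1 (Suc d) + smult (- 1) p"
  \<comment> \<open>The degree bound on p leaves the leading term of the monomial intact.\<close>
  have "coeff ?r (Suc d) = 1"
    using p by (simp add: coeff_eq_0)
  then have "?r \<noteq> 0" by (metis coeff_0 zero_neq_one)
  moreover have "act ?r (j x) = zero"
    using p x by (simp add: act_add act_smult act_monom j_funpow add_uminus
        del: funpow.simps smult_minus_left)
  ultimately show ?thesis using that by blast
qed

section \<open>The unimodular part and recurrent vectors\<close>

text \<open>The set G of the introduction. An annihilator, unlike a decomposition into eigenvectors,
  transfers through \<open>j\<close> and survives limits for fixed L.\<close>

definition unimodular_part :: "'v set" where
  "unimodular_part = {z \<in> fcarrier E. \<exists>L. finite L \<and> L \<subseteq> sphere 0 1 \<and> act (lin_factors L) (j z) = zero}"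

lemma vsubspace_kernel: "vsubspace E {z \<in> fcarrier E. act p (j z) = zero}"
  by (auto simp: vsubspace_def j_zero j_add j_scale act_of_add act_of_sc)

lemma vsubspace_unimodular_part: "vsubspace E unimodular_part"
  unfolding vsubspace_def
proof (intro conjI ballI)
  show "vzero E \<in> unimodular_part"
    by (auto simp: unimodular_part_def j_zero intro!: exI[of _ "{}"])
next
  fix y z assume "y \<in> unimodular_part" "z \<in> unimodular_part"
  then obtain L M where L: "finite L" "L \<subseteq> sphere 0 1" "act (lin_factors L) (j y) = zero"
    and M: "finite M" "M \<subseteq> sphere 0 1" "act (lin_factors M) (j z) = zero"
    and in_E: "y \<in> fcarrier E" "z \<in> fcarrier E" by (auto simp: unimodular_part_def)
  have "act (lin_factors (L \<union> M)) (j (vadd E y z)) = zero"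
    using L M in_E lin_factors_mono[of L "L \<union> M" "j y"] lin_factors_mono[of M "L \<union> M" "j z"]
    by (simp add: j_add act_of_add)
  then show "vadd E y z \<in> unimodular_part"
    using L M in_E by (auto simp: unimodular_part_def intro!: exI[of _ "L \<union> M"])
next
  fix c y assume "c \<in> scalars E" "y \<in> unimodular_part"
  then show "vscale E c y \<in> unimodular_part"
    by (auto simp: unimodular_part_def j_scale act_of_sc)
qed (auto simp: unimodular_part_def)

lemma T_unimodular_part: "T ` unimodular_part \<subseteq> unimodular_part"
  by (auto simp: unimodular_part_def j_T act_of_S)

text \<open>One finite root set M serves all N coordinates. The gauge is the sum of |l^n - 1| over
  M: if it tends to 0 then every l^n tends to 1, and each coordinate returns.\<close>

lemma unimodular_part_frec:
  assumes F: "rotation_family F"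
  shows "PiE {..<N} (\<lambda>_. unimodular_part) \<subseteq> frec F (pow_top E N) (diag_op T N)"
proof
  have up: "\<forall>A\<in>F. \<forall>B. A \<subseteq> B \<longrightarrow> B \<in> F"
    using F by (simp add: rotation_family_def)
  fix z assume z: "z \<in> PiE {..<N} (\<lambda>_. unimodular_part)"
  then have ex: "\<forall>i\<in>{..<N}. \<exists>L. finite L \<and> L \<subseteq> sphere 0 1 \<and> act (lin_factors L) (j (z i)) = zero"
    and in_E: "\<And>i. i < N \<Longrightarrow> z i \<in> fcarrier E"
    by (auto simp: unimodular_part_def PiE_iff)
  obtain L where L: "\<And>i. i < N \<Longrightarrow> finite (L i) \<and> L i \<subseteq> sphere 0 1 \<and>
      act (lin_factors (L i)) (j (z i)) = zero"
    using bchoice[OF ex] by auto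
  define M where "M = (\<Union>i<N. L i)"
  have M: "finite M" "M \<subseteq> sphere 0 1" using L by (auto simp: M_def)
  have zM: "act (lin_factors M) (j (z i)) = zero" if i: "i < N" for i
  proof (rule lin_factors_mono)
    show "L i \<subseteq> M" using i by (auto simp: M_def)
  qed (use L[OF i] in_E[OF i] M in simp_all)
  show "z \<in> frec F (pow_top E N) (diag_op T N)"
  proof (rule frec_pow_if_limitin[where g = "\<lambda>n. \<Sum>l\<in>M. cmod (l ^ n - 1)", OF up])
    show "z \<in> PiE {..<N} (\<lambda>_. topspace (ftop E))"
      using z in_E by (auto simp: PiE_iff)
  next
    fix e :: real assume e: "e > 0"
    \<comment> \<open>Adding 1 to the cardinality makes the final inequality strict and covers empty
      M.\<close>
    define d where "d = e / (real (card M) + 1)"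
    have d: "d > 0" using e by (simp add: d_def)
    have "real (card M) * d < e" using e by (simp add: d_def field_simps)
    moreover have "(\<Sum>l\<in>M. cmod (l ^ n - 1)) \<le> real (card M) * d"
      if "\<forall>l\<in>M. cmod (l ^ n - 1) < d" for n
      using that by (intro sum_bounded_above less_imp_le) blast
    ultimately have "{n. \<forall>l\<in>M. cmod (l ^ n - 1) < d} \<subseteq> {n. (\<Sum>l\<in>M. cmod (l ^ n - 1)) < e}"
      by fastforce
    moreover have "{n. \<forall>l\<in>M. cmod (l ^ n - 1) < d} \<in> F"
      using F M d unfolding rotation_family_def by blast
    ultimately show "{n. (\<Sum>l\<in>M. cmod (l ^ n - 1)) < e} \<in> F"
      using up by blast
  next
    fix i n assume i: "i < N" and lim: "(\<lambda>k. \<Sum>l\<in>M. cmod (l ^ n k - 1)) \<longlonglongrightarrow> 0"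
    have "(\<lambda>k. l ^ n k) \<longlonglongrightarrow> 1" if "l \<in> M" for l
    proof (rule Lim_null[THEN iffD2], rule Lim_null_comparison[OF _ lim])
      show "\<forall>\<^sub>F k in sequentially. cmod (l ^ n k - 1) \<le> (\<Sum>l\<in>M. cmod (l ^ n k - 1))"
        by (intro always_eventually allI member_le_sum) (use that M in auto)
    qed
    then show "limitin (ftop E) (\<lambda>k. (T ^^ n k) (z i)) (z i) sequentially"
      using conv_funpow_annihilated[OF M(1) _ zM[OF i]] in_E[OF i]
      by (simp add: limitin_orbit_iff)
  qed (auto intro: sum_nonneg)
qed

lemma frec_returns:
  assumes x: "x \<in> frec F (ftop E) T" and e: "e > 0"
  shows "{n. vdist E ((T ^^ n) x) x < e} \<in> F"
proof -
  have x_in: "x \<in> fcarrier E" using x by (simp add: frec_def)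
  have "{n. (T ^^ n) x \<in> M.mball x e} \<in> F"
    using x M.openin_mball[of x e] x_in e unfolding frec_def ftop_eq by fastforce
  moreover have "{n. (T ^^ n) x \<in> M.mball x e} = {n. vdist E ((T ^^ n) x) x < e}"
    using x_in by (auto simp: M.commute)
  ultimately show ?thesis by simp
qed

text \<open>The gauge is the distance of T^n x from x: whenever x returns along a sequence of times,
  so does every p(T) x.\<close>

lemma orbit_poly_frec:
  assumes up: "\<forall>A\<in>F. \<forall>B. A \<subseteq> B \<longrightarrow> B \<in> F" and x: "x \<in> frec F (ftop E) T"
  shows "PiE {..<N} (\<lambda>_. orbit_poly Q x) \<subseteq> frec F (pow_top E N) (diag_op T N)"
proof
  have x_in: "x \<in> fcarrier E" using x by (simp add: frec_def)
  fix z assume z: "z \<in> PiE {..<N} (\<lambda>_. orbit_poly Q x)"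
  show "z \<in> frec F (pow_top E N) (diag_op T N)"
  proof (rule frec_pow_if_limitin[where g = "\<lambda>n. vdist E ((T ^^ n) x) x", OF up])
    show "z \<in> PiE {..<N} (\<lambda>_. topspace (ftop E))"
      using z by (auto simp: PiE_iff orbit_poly_def)
  next
    fix e :: real assume e: "e > 0"
    with x show "{n. vdist E ((T ^^ n) x) x < e} \<in> F"
      by (rule frec_returns)
  next
    fix i n assume i: "i < N" and "(\<lambda>k. vdist E ((T ^^ n k) x) x) \<longlonglongrightarrow> 0"
    then have "conv (\<lambda>k. (S ^^ n k) (j x)) (j x)"
      using x_in by (simp flip: limitin_orbit_iff_dist limitin_orbit_iff)
    moreover obtain p where "z i \<in> fcarrier E" "j (z i) = act p (j x)"
      using z i by (auto simp: PiE_iff orbit_poly_def)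
    ultimately show "limitin (ftop E) (\<lambda>k. (T ^^ n k) (z i)) (z i) sequentially"
      using recurrent_act by (simp add: limitin_orbit_iff)
  qed auto
qed

text \<open>Infinite return sets permit the choice of \<open>n k\<close> at least k, so the times
  tend to infinity, as the eigenvalue lemmas require.\<close>

lemma frec_limit_sequence:
  assumes "\<forall>A\<in>F. infinite A" and x: "x \<in> frec F (ftop E) T"
  obtains n where "filterlim n at_top sequentially" "conv (\<lambda>k. (S ^^ n k) (j x)) (j x)"
proof -
  have x_in: "x \<in> fcarrier E" using x by (simp add: frec_def)
  have "\<exists>n\<ge>k. vdist E ((T ^^ n) x) x < inverse (real (Suc k))" for k
  proof -
    have "infinite {n. vdist E ((T ^^ n) x) x < inverse (real (Suc k))}"
      using assms(1) frec_returns[OF x] by simp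
    then show ?thesis
      by (simp add: infinite_nat_iff_unbounded_le)
  qed
  then obtain n where n: "\<And>k. n k \<ge> k" "\<And>k. vdist E ((T ^^ n k) x) x < inverse (real (Suc k))"
    by metis
  have "(\<lambda>k. vdist E ((T ^^ n k) x) x) \<longlonglongrightarrow> 0"
    by (rule tendsto_sandwich[OF _ _ tendsto_const LIMSEQ_inverse_real_of_nat])
      (use less_imp_le[OF n(2)] in \<open>auto intro!: always_eventually simp del: of_nat_Suc\<close>)
  then have "conv (\<lambda>k. (S ^^ n k) (j x)) (j x)"
    using x_in by (simp flip: limitin_orbit_iff_dist limitin_orbit_iff)
  moreover have "filterlim n at_top sequentially"
    by (rule filterlim_at_top_mono[OF filterlim_ident]) (use n in auto)
  ultimately show ?thesis using that by blast
qed

lemma frec_subset_unimodular_part: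
  assumes "\<forall>A\<in>F. infinite A" and x: "x \<in> frec F (ftop E) T"
    and fin: "\<not> infinite_dimensional E (orbit_poly scalar_polys x)"
  shows "x \<in> unimodular_part"
proof -
  have x_in: "x \<in> fcarrier E" using x by (simp add: frec_def)
  obtain n where "filterlim n at_top sequentially" "conv (\<lambda>k. (S ^^ n k) (j x)) (j x)"
    using frec_limit_sequence[OF assms(1,2)] by blast
  moreover obtain p where "p \<noteq> 0" "act p (j x) = zero"
    using orbit_poly_finite_dim[OF x_in fin] .
  ultimately obtain L where "finite L" "L \<subseteq> sphere 0 1" "act (lin_factors L) (j x) = zero"
    using recurrent_annihilated[OF j_in[OF x_in]] by metis
  then show ?thesis
    using x_in unfolding unimodular_part_def by blast
qed

text \<open>A finite spanning set has a common annihilator; it kills the dense unimodular part and,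
  by continuity, the whole space.\<close>

lemma unimodular_part_dense_finite_dim:
  assumes dense: "fcarrier E \<subseteq> ftop E closure_of unimodular_part"
    and fin: "\<not> infinite_dimensional E unimodular_part"
  shows "unimodular_part = fcarrier E"
proof -
  obtain B where B: "finite B" "B \<subseteq> unimodular_part" "unimodular_part \<subseteq> vspan E B"
    using fin by (auto simp: infinite_dimensional_def)
  then have ex: "\<forall>b\<in>B. \<exists>L. finite L \<and> L \<subseteq> sphere 0 1 \<and> act (lin_factors L) (j b) = zero"
    unfolding unimodular_part_def by blast
  obtain L where L: "\<And>b. b \<in> B \<Longrightarrow> finite (L b) \<and> L b \<subseteq> sphere 0 1 \<and>
      act (lin_factors (L b)) (j b) = zero"
    using bchoice[OF ex] by auto
  define M where "M = (\<Union>b\<in>B. L b)"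
  have M: "finite M" "M \<subseteq> sphere 0 1" using L B by (auto simp: M_def)
  have "B \<subseteq> {z \<in> fcarrier E. act (lin_factors M) (j z) = zero}"
  proof
    fix b assume b: "b \<in> B"
    then have b_in: "b \<in> fcarrier E" using B by (auto simp: unimodular_part_def)
    have "L b \<subseteq> M" using b by (auto simp: M_def)
    then have "act (lin_factors M) (j b) = zero"
      using lin_factors_mono[OF _ M(1) j_in[OF b_in]] L[OF b] by blast
    with b_in show "b \<in> {z \<in> fcarrier E. act (lin_factors M) (j z) = zero}" by simp
  qed
  \<comment> \<open>The kernel is a subspace, so with B it contains the span of B.\<close>
  then have kills: "act (lin_factors M) (j z) = zero" if "z \<in> unimodular_part" for z
    using vspan_subset[OF vsubspace_kernel, of B "lin_factors M"] B that by blast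
  have "x \<in> unimodular_part" if x: "x \<in> fcarrier E" for x
  proof -
    have "\<forall>k. \<exists>y\<in>unimodular_part. y \<in> M.mball x (inverse (real (Suc k)))"
      using dense x by (auto simp: ftop_eq M.metric_closure_of)
    then obtain u where u: "\<And>k. u k \<in> unimodular_part"
      "\<And>k. u k \<in> M.mball x (inverse (real (Suc k)))" by metis
    have u_in: "u k \<in> fcarrier E" for k using u(2)[of k] by simp
    have "(\<lambda>k. vdist E (u k) x) \<longlonglongrightarrow> 0"
    proof (rule tendsto_sandwich[OF _ _ tendsto_const LIMSEQ_inverse_real_of_nat])
      have "vdist E (u k) x \<le> inverse (real (Suc k))" for k
        using u(2)[of k] by (simp add: M.commute less_imp_le del: of_nat_Suc)
      then show "\<forall>\<^sub>F k in sequentially. vdist E (u k) x \<le> inverse (real (Suc k))"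
        by (intro always_eventually allI)
    qed simp
    then have "limitin (ftop E) u x sequentially"
      using u_in x by (simp add: ftop_eq M.limitin_metric_dist_null)
    then have "conv (\<lambda>k. act (lin_factors M) (j (u k))) (act (lin_factors M) (j x))"
      using u_in x by (intro conv_act) (simp add: j_conv)
    then have "act (lin_factors M) (j x) = zero"
      using kills[OF u(1)] conv_unique conv_const[OF zero_in] by simp
    then show ?thesis using M x by (auto simp: unimodular_part_def)
  qed
  then show ?thesis by (auto simp: unimodular_part_def)
qed

theorem has_rec_subspace:
  assumes F: "rotation_family F"
    and E: "infinite_dimensional E (fcarrier E)" and rec: "F_recurrent F (ftop E) T"
  shows "has_rec_subspace F E T"
proof -
  have up: "\<forall>A\<in>F. \<forall>B. A \<subseteq> B \<longrightarrow> B \<in> F" and inf: "\<forall>A\<in>F. infinite A"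
    using F by (simp_all add: rotation_family_def)
  show ?thesis
  proof (cases "infinite_dimensional E unimodular_part")
    case True
    then show ?thesis
      unfolding has_rec_subspace_def
      using vsubspace_unimodular_part T_unimodular_part unimodular_part_frec[OF F] by metis
  next
    case False
    \<comment> \<open>Otherwise the unimodular part would contain the dense set of recurrent
      vectors, hence be the whole space, which is infinite-dimensional.\<close>
    have "\<exists>x\<in>frec F (ftop E) T. infinite_dimensional E (orbit_poly scalar_polys x)"
    proof (rule ccontr)
      assume "\<not> ?thesis"
      then have "frec F (ftop E) T \<subseteq> unimodular_part"
        using frec_subset_unimodular_part inf by blast
      then have "fcarrier E \<subseteq> ftop E closure_of unimodular_part"
        using rec closure_of_mono unfolding F_recurrent_def topspace_ftop by metis
      with False E show False
        using unimodular_part_dense_finite_dim by metis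
    qed
    then obtain x where x: "x \<in> frec F (ftop E) T"
      and inf_dim: "infinite_dimensional E (orbit_poly scalar_polys x)" by blast
    have x_in: "x \<in> fcarrier E" using x by (simp add: frec_def)
    have "vsubspace E (orbit_poly scalar_polys x)"
      by (rule vsubspace_orbit_poly[OF x_in]) auto
    moreover have "T ` orbit_poly scalar_polys x \<subseteq> orbit_poly scalar_polys x"
    proof
      fix y assume "y \<in> T ` orbit_poly scalar_polys x"
      then obtain z p where "y = T z" "z \<in> fcarrier E" "p \<in> scalar_polys" "j z = act p (j x)"
        by (auto simp: orbit_poly_def)
      \<comment> \<open>Applying T multiplies the polynomial by X, that is, prepends a zero
        coefficient.\<close>
      then have "j y = act (pCons 0 p) (j x)" "pCons 0 p \<in> scalar_polys" "y \<in> fcarrier E"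
        using x_in by (simp_all add: j_T act_pCons coeff_pCons split: nat.split)
      then show "y \<in> orbit_poly scalar_polys x"
        unfolding orbit_poly_def by blast
    qed
    ultimately show ?thesis
      unfolding has_rec_subspace_def using inf_dim orbit_poly_frec[OF up x, of _ scalar_polys] by metis
  qed
qed

end

section \<open>F-spaces and their complexifications as instances of the abstract setting\<close>

locale F_space_op =
  fixes E :: "'v fspace" and T :: "'v \<Rightarrow> 'v"
  assumes F_space: "F_space E" and T: "cont_lin_op E T"
begin

sublocale M: Metric_space "fcarrier E" "vdist E"
  using F_space by (simp add: F_space_def)

lemma vs: "vector_space_on E"
  using F_space by (simp add: F_space_def)

lemma closed [simp]:
  "vzero E \<in> fcarrier E"
  "x \<in> fcarrier E \<Longrightarrow> y \<in> fcarrier E \<Longrightarrow> vadd E x y \<in> fcarrier E"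
  "c \<in> scalars E \<Longrightarrow> x \<in> fcarrier E \<Longrightarrow> vscale E c x \<in> fcarrier E"
  "x \<in> fcarrier E \<Longrightarrow> T x \<in> fcarrier E"
  using vs T by (auto simp: vector_space_on_def cont_lin_op_def)

lemma of_real_scalars [simp]: "complex_of_real a \<in> scalars E"
  using vs by (auto simp: vector_space_on_def)

lemma zero_one_scalars [simp]: "0 \<in> scalars E" "1 \<in> scalars E"
  using of_real_scalars[of 0] of_real_scalars[of 1] by simp_all

lemma linear_laws:
  "x \<in> fcarrier E \<Longrightarrow> y \<in> fcarrier E \<Longrightarrow> z \<in> fcarrier E \<Longrightarrow> vadd E (vadd E x y) z = vadd E x (vadd E y z)"
  "x \<in> fcarrier E \<Longrightarrow> vadd E x (vzero E) = x"
  "c \<in> scalars E \<Longrightarrow> x \<in> fcarrier E \<Longrightarrow> y \<in> fcarrier E \<Longrightarrow>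
    vscale E c (vadd E x y) = vadd E (vscale E c x) (vscale E c y)"
  "c \<in> scalars E \<Longrightarrow> d \<in> scalars E \<Longrightarrow> x \<in> fcarrier E \<Longrightarrow>
    vscale E (c + d) x = vadd E (vscale E c x) (vscale E d x)"
  "c \<in> scalars E \<Longrightarrow> d \<in> scalars E \<Longrightarrow> x \<in> fcarrier E \<Longrightarrow>
    vscale E c (vscale E d x) = vscale E (c * d) x"
  "x \<in> fcarrier E \<Longrightarrow> vscale E 1 x = x"
  "x \<in> fcarrier E \<Longrightarrow> y \<in> fcarrier E \<Longrightarrow> T (vadd E x y) = vadd E (T x) (T y)"
  "c \<in> scalars E \<Longrightarrow> x \<in> fcarrier E \<Longrightarrow> T (vscale E c x) = vscale E c (T x)"
  using vs T unfolding vector_space_on_def cont_lin_op_def by (blast | metis)+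

lemma add_commute: "x \<in> fcarrier E \<Longrightarrow> y \<in> fcarrier E \<Longrightarrow> vadd E x y = vadd E y x"
  using vs unfolding vector_space_on_def by blast

lemma add_left_commute:
  "x \<in> fcarrier E \<Longrightarrow> y \<in> fcarrier E \<Longrightarrow> z \<in> fcarrier E \<Longrightarrow> vadd E x (vadd E y z) = vadd E y (vadd E x z)"
  by (metis linear_laws(1) add_commute)

lemma zero_add: "x \<in> fcarrier E \<Longrightarrow> vadd E (vzero E) x = x"
  by (metis linear_laws(2) add_commute closed(1))

lemma scale_0 [simp]:
  assumes x: "x \<in> fcarrier E"
  shows "vscale E 0 x = vzero E"
proof -
  let ?z = "vscale E 0 x"
  have "\<forall>x\<in>fcarrier E. \<exists>y\<in>fcarrier E. vadd E x y = vzero E"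
    using vs unfolding vector_space_on_def by (elim conjE)
  moreover have "?z \<in> fcarrier E" using x by simp
  ultimately obtain y where y: "y \<in> fcarrier E" "vadd E ?z y = vzero E" by blast
  have "?z = vadd E ?z (vadd E ?z y)"
    using x y by (simp add: linear_laws(2))
  also have "\<dots> = vadd E (vscale E (0 + 0) x) y"
    using x y by (simp only: linear_laws(1,4) closed zero_one_scalars)
  finally show ?thesis using y by simp
qed

lemma scale_zero [simp]: "c \<in> scalars E \<Longrightarrow> vscale E c (vzero E) = vzero E"
  using linear_laws(5)[of c 0 "vzero E"] by simp

lemma topspace_ftop [simp]: "topspace (ftop E) = fcarrier E"
  by (simp add: ftop_def)

text \<open>\<open>limitin\<close> restricts only the eventual terms, while the abstract axioms
  require every term to lie in the carrier.\<close>

definition conv_in :: "(nat \<Rightarrow> 'v) \<Rightarrow> 'v \<Rightarrow> bool" where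
  "conv_in u x \<longleftrightarrow> (\<forall>n. u n \<in> fcarrier E) \<and> limitin (ftop E) u x sequentially"

lemma conv_in_carrier: "conv_in u x \<Longrightarrow> u n \<in> fcarrier E" "conv_in u x \<Longrightarrow> x \<in> fcarrier E"
  by (auto simp: conv_in_def limitin_def)

lemma conv_in_const: "x \<in> fcarrier E \<Longrightarrow> conv_in (\<lambda>_. x) x"
  by (simp add: conv_in_def)

lemma conv_in_unique: "conv_in u x \<Longrightarrow> conv_in u y \<Longrightarrow> x = y"
  unfolding conv_in_def ftop_def using M.limitin_metric_unique[OF _ _ sequentially_bot] by blast

lemma conv_in_T: "conv_in u x \<Longrightarrow> conv_in (\<lambda>n. T (u n)) (T x)"
  using T continuous_map_limit[of "ftop E" "ftop E" T u x sequentially]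
  by (auto simp: conv_in_def cont_lin_op_def comp_def)

lemma conv_in_add:
  assumes "conv_in u x" "conv_in v y"
  shows "conv_in (\<lambda>n. vadd E (u n) (v n)) (vadd E x y)"
proof -
  have "limitin (prod_topology (ftop E) (ftop E)) (\<lambda>n. (u n, v n)) (x, y) sequentially"
    using assms by (simp add: limitin_pairwise comp_def conv_in_def)
  with F_space have "limitin (ftop E) ((\<lambda>(x, y). vadd E x y) \<circ> (\<lambda>n. (u n, v n))) (vadd E x y) sequentially"
    unfolding F_space_def using continuous_map_limit by fastforce
  then show ?thesis using assms by (simp add: conv_in_def comp_def)
qed

lemma conv_in_scale:
  assumes "\<And>n. a n \<in> scalars E" "c \<in> scalars E" "a \<longlonglongrightarrow> c" "conv_in u x"
  shows "conv_in (\<lambda>n. vscale E (a n) (u n)) (vscale E c x)"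
proof -
  have "limitin (prod_topology (top_of_set (scalars E)) (ftop E)) (\<lambda>n. (a n, u n)) (c, x) sequentially"
    using assms by (simp add: limitin_pairwise comp_def conv_in_def limitin_subtopology)
  with F_space have "limitin (ftop E) ((\<lambda>(c, x). vscale E c x) \<circ> (\<lambda>n. (a n, u n))) (vscale E c x) sequentially"
    unfolding F_space_def using continuous_map_limit by fastforce
  then show ?thesis using assms by (simp add: conv_in_def comp_def)
qed

lemma conv_ext_complex:
  assumes "scalars E = UNIV"
  shows "conv_ext (fcarrier E) (vadd E) (vzero E) (vscale E) T conv_in E T (\<lambda>x. x)"
proof (intro conv_ext.intro conv_op.intro conv_ext_axioms.intro F_space T)
  show "vadd E x y = vadd E y x" if "x \<in> fcarrier E" "y \<in> fcarrier E" for x y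
    using that by (rule add_commute)
  show "conv_in (\<lambda>n. u n) x \<longleftrightarrow> limitin (ftop E) u x sequentially"
    if "\<And>n. u n \<in> fcarrier E" "x \<in> fcarrier E" for u x
    using that by (simp add: conv_in_def)
  show "x = y" if "conv_in u x" "conv_in u y" for u x y
    using that by (rule conv_in_unique)
  show "u n \<in> fcarrier E" "x \<in> fcarrier E" if "conv_in u x" for u n x
    using that by (rule conv_in_carrier)+
  show "conv_in (\<lambda>n. vscale E (a n) (u n)) (vscale E c x)" if "a \<longlonglongrightarrow> c" "conv_in u x" for a c u x
    using that assms by (intro conv_in_scale) auto
qed (simp_all add: assms linear_laws conv_in_const conv_in_add conv_in_T)

text \<open>Real numbers are scalars in both cases, so the laws of \<open>rscale\<close> carry no
  membership conditions on scalars.\<close>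

definition rscale :: "real \<Rightarrow> 'v \<Rightarrow> 'v" where
  "rscale a x = vscale E (of_real a) x"

lemma rscale_laws:
  "x \<in> fcarrier E \<Longrightarrow> rscale a x \<in> fcarrier E"
  "x \<in> fcarrier E \<Longrightarrow> y \<in> fcarrier E \<Longrightarrow> rscale a (vadd E x y) = vadd E (rscale a x) (rscale a y)"
  "x \<in> fcarrier E \<Longrightarrow> rscale (a + b) x = vadd E (rscale a x) (rscale b x)"
  "x \<in> fcarrier E \<Longrightarrow> rscale a (rscale b x) = rscale (a * b) x"
  "x \<in> fcarrier E \<Longrightarrow> rscale 1 x = x"
  "x \<in> fcarrier E \<Longrightarrow> rscale 0 x = vzero E"
  "rscale a (vzero E) = vzero E"
  "x \<in> fcarrier E \<Longrightarrow> T (rscale a x) = rscale a (T x)"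
  unfolding rscale_def by (simp_all add: linear_laws)

text \<open>Expands the difference that occurs in the real part of a complex product.\<close>

lemma rscale_diff: "x \<in> fcarrier E \<Longrightarrow> rscale (a - b) x = vadd E (rscale a x) (rscale (- b) x)"
  using rscale_laws(3)[of x a "- b"] by simp

lemma cx_scale_eq:
  "cx_scale E l p = (vadd E (rscale (Re l) (fst p)) (rscale (- Im l) (snd p)),
     vadd E (rscale (Im l) (fst p)) (rscale (Re l) (snd p)))"
  by (simp add: cx_scale_def rscale_def)

lemma conv_in_rscale:
  "a \<longlonglongrightarrow> c \<Longrightarrow> conv_in u x \<Longrightarrow> conv_in (\<lambda>n. rscale (a n) (u n)) (rscale c x)"
  unfolding rscale_def by (intro conv_in_scale tendsto_of_real) auto

text \<open>The complexification consists of pairs with coordinatewise convergence, and x is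
  embedded as x + i0.\<close>

lemma conv_ext_real:
  assumes real: "scalars E = \<real>"
  shows "conv_ext (fcarrier E \<times> fcarrier E) (\<lambda>p q. (vadd E (fst p) (fst q), vadd E (snd p) (snd q)))
    (vzero E, vzero E) (cx_scale E) (cx_op T)
    (\<lambda>u x. conv_in (\<lambda>n. fst (u n)) (fst x) \<and> conv_in (\<lambda>n. snd (u n)) (snd x)) E T (\<lambda>x. (x, vzero E))"
  (is "conv_ext ?C ?add ?zero ?sc ?S ?conv E T ?j")
proof (intro conv_ext.intro conv_op.intro conv_ext_axioms.intro F_space T)
  show "?zero \<in> ?C" by simp
  show "?add x y \<in> ?C" if "x \<in> ?C" "y \<in> ?C" for x y
    using that by auto
  show "?sc c x \<in> ?C" if "x \<in> ?C" for c x
    using that by (auto simp: cx_scale_eq rscale_laws)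
  show "?S x \<in> ?C" if "x \<in> ?C" for x
    using that by (auto simp: cx_op_def)
  show "?add (?add x y) z = ?add x (?add y z)" if "x \<in> ?C" "y \<in> ?C" "z \<in> ?C" for x y z
    using that by (auto simp: linear_laws)
  show "?add x y = ?add y x" if "x \<in> ?C" "y \<in> ?C" for x y
    using that add_commute by auto
  show "?add x ?zero = x" if "x \<in> ?C" for x
    using that by (auto simp: linear_laws)
  show "?sc c (?add x y) = ?add (?sc c x) (?sc c y)" if "x \<in> ?C" "y \<in> ?C" for c x y
    using that by (auto simp: cx_scale_eq rscale_laws linear_laws add_left_commute)
  show "?sc (c + d) x = ?add (?sc c x) (?sc d x)" if "x \<in> ?C" for c d x
    using that by (auto simp: cx_scale_eq rscale_laws rscale_diff linear_laws add_left_commute)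
  show "?sc c (?sc d x) = ?sc (c * d) x" if "x \<in> ?C" for c d x
    using that by (auto simp: cx_scale_eq rscale_laws rscale_diff linear_laws add_left_commute add_commute)
  show "?sc 1 x = x" if "x \<in> ?C" for x
    using that by (auto simp: cx_scale_eq rscale_laws linear_laws zero_add)
  show "?sc 0 x = ?zero" if "x \<in> ?C" for x
    using that by (auto simp: cx_scale_eq rscale_laws linear_laws)
  show "?S (?add x y) = ?add (?S x) (?S y)" if "x \<in> ?C" "y \<in> ?C" for x y
    using that by (auto simp: cx_op_def linear_laws)
  show "?S (?sc c x) = ?sc c (?S x)" if "x \<in> ?C" for c x
    using that by (auto simp: cx_op_def cx_scale_eq rscale_laws linear_laws)
  show "?conv (\<lambda>_. x) x" if "x \<in> ?C" for x
    using that by (auto intro: conv_in_const)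
  show "?conv (\<lambda>n. ?add (u n) (v n)) (?add x y)" if "?conv u x" "?conv v y" for u v x y
    using that by (simp add: conv_in_add)
  show "?conv (\<lambda>n. ?sc (a n) (u n)) (?sc c x)" if "a \<longlonglongrightarrow> c" "?conv u x" for a c u x
    unfolding cx_scale_eq fst_conv snd_conv using that
    by (intro conjI conv_in_add conv_in_rscale tendsto_intros) auto
  show "?conv (\<lambda>n. ?S (u n)) (?S x)" if "?conv u x" for u x
    using that by (simp add: cx_op_def conv_in_T)
  show "x = y" if "?conv u x" "?conv u y" for u x y
    using that conv_in_unique by (auto simp: prod_eq_iff)
  show "u n \<in> ?C" "x \<in> ?C" if "?conv u x" for u n x
    using that conv_in_carrier by (auto simp: mem_Times_iff)
  show "?j x \<in> ?C" if "x \<in> fcarrier E" for x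
    using that by simp
  show "?j (vzero E) = ?zero" by simp
  show "?j (vadd E x y) = ?add (?j x) (?j y)" if "x \<in> fcarrier E" "y \<in> fcarrier E" for x y
    by (simp add: linear_laws)
  show "?j (vscale E c x) = ?sc c (?j x)" if "c \<in> scalars E" "x \<in> fcarrier E" for c x
  proof -
    \<comment> \<open>For real c the mixed terms of \<open>cx_scale\<close> vanish, so the imaginary
      component stays zero.\<close>
    have "Im c = 0" "complex_of_real (Re c) = c"
      using that real by (simp_all add: complex_is_Real_iff)
    moreover from this have "vscale E c x = rscale (Re c) x"
      by (simp add: rscale_def)
    ultimately show ?thesis using that by (simp add: cx_scale_eq rscale_laws linear_laws)
  qed
  show "?j (T x) = ?S (?j x)" if "x \<in> fcarrier E" for x
    \<comment> \<open>T fixes zero: write zero as 0 times itself and pull out the scalar.\<close>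
    using rscale_laws(8)[of "vzero E" 0] by (simp add: cx_op_def rscale_laws)
  show "?conv (\<lambda>n. ?j (u n)) (?j x) \<longleftrightarrow> limitin (ftop E) u x sequentially"
    if "\<And>n. u n \<in> fcarrier E" "x \<in> fcarrier E" for u x
    using that by (simp add: conv_in_def)
qed

end

lemma has_rec_subspace_if_rotation_family:
  fixes X :: "'v fspace"
  assumes F: "rotation_family F"
    and X: "sep_inf_F_space X" "cont_lin_op X T" "F_recurrent F (ftop X) T"
  shows "has_rec_subspace F X T"
proof -
  interpret F_space_op X T
    using X by unfold_locales (auto simp: sep_inf_F_space_def)
  have inf: "infinite_dimensional X (fcarrier X)"
    using X by (simp add: sep_inf_F_space_def)
  consider "scalars X = UNIV" | "scalars X = \<real>"
    using vs by (auto simp: vector_space_on_def)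
  then show ?thesis
  proof cases
    case 1
    show ?thesis
      by (rule conv_ext.has_rec_subspace[OF conv_ext_complex[OF 1] F inf X(3)])
  next
    case 2
    show ?thesis
      by (rule conv_ext.has_rec_subspace[OF conv_ext_real[OF 2] F inf X(3)])
  qed
qed

theorem mainTheorem16:
  shows "(\<forall>F. furstenberg_family F \<and> eigen_hyp F \<longrightarrow>
           (\<forall>(X :: 'a fspace) T. sep_inf_F_space X \<and> cont_lin_op X T \<and>
              F_recurrent F (ftop X) T \<longrightarrow> has_rec_subspace F X T)) \<and>
         (\<forall>F \<in> {fam_I, fam_AP, fam_BD, fam_uD, fam_lD, fam_S, fam_IPstar, fam_Deltastar}.
           (\<forall>(X :: 'a fspace) T. sep_inf_F_space X \<and> cont_lin_op X T \<and>
              F_recurrent F (ftop X) T \<longrightarrow> has_rec_subspace F X T))"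
proof (intro conjI allI ballI impI; elim conjE)
  fix F and X :: "'a fspace" and T
  assume F: "furstenberg_family F" "eigen_hyp F"
    and X: "sep_inf_F_space X" "cont_lin_op X T" "F_recurrent F (ftop X) T"
  have inf: "\<forall>A\<in>F. infinite A" and up: "\<forall>A\<in>F. \<forall>B. A \<subseteq> B \<longrightarrow> B \<in> F"
    using F(1) by (simp_all add: furstenberg_family_def)
  \<comment> \<open>The hypothesis on all operators is traded here for the return times of
    rotations.\<close>
  have "rotation_family F"
    unfolding rotation_family_def
    by (intro conjI inf up allI impI eigen_hyp_rotation[OF F(2) up]; elim conjE)
  then show "has_rec_subspace F X T"
    using X by (rule has_rec_subspace_if_rotation_family)
next
  fix F and X :: "'a fspace" and T
  assume F: "F \<in> {fam_I, fam_AP, fam_BD, fam_uD, fam_lD, fam_S, fam_IPstar, fam_Deltastar}"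
    and X: "sep_inf_F_space X" "cont_lin_op X T" "F_recurrent F (ftop X) T"
  show "has_rec_subspace F X T"
    using fam_rotation_family[OF F] X by (rule has_rec_subspace_if_rotation_family)
qed

end
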